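(* Let $k$ be a field and let $S\subset\mathbb{P}^n$ be a finite set of $k$-points. Assume that $S=S_1\sqcup S_2$ with $S_1$ and $S_2$ linearly independent and such that $$\operatorname{span}(S_1)\cap S_2=\operatorname{span}(S_2)\cap S_1=\emptyset.$$ Then $S$ is Koszul.
   Context: Fix a ground field $k$; points of $\mathbb{P}^n$ are $k$-points. A finite set of points of $\mathbb{P}^n$ is linearly independent if vectors in $k^{n+1}$ representing its points are linearly independent. For a finite subset $T\subset\mathbb{P}^n$, $\operatorname{span}(T)$ is the linear span of $T$, a linear subspace of $\mathbb{P}^n$ (empty if $T=\emptyset$). For a finite set $S\subset\mathbb{P}^n$, its homogeneous coordinate ring is $A_S=k[x_0,\dots,x_n]/I_S$, where $I_S$ is the homogeneous ideal generated by the homogeneous polynomials vanishing on $S$ (with the convention $A_\emptyset=k$). A graded $k$-algebra $A=\bigoplus_{m\ge 0}A_m$ with $A_0=k$ is Koszul if $\operatorname{Tor}^A_{i,j}(k,k)=0$ whenever $i\ne j$, where $j$ denotes the internal degree. The set $S$ is called Koszul if $A_S$ is Koszul. *)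

theory Defs
  imports
    "HOL-Analysis.Cartesian_Space"
    "HOL-Library.Poly_Mapping"
    "HOL-Algebra.QuotRing"
    "HOL-Algebra.Subrings"
begin

text \<open>The ground field of the algebra is its degree zero part \<open>G 0\<close>.\<close>

locale graded_algebra = cring R for R :: "('a, 'c) ring_scheme" (structure) +
  fixes G :: "nat \<Rightarrow> 'a set"
  assumes degree_subgroup: "additive_subgroup (G m) R"
    and degree_mult: "\<lbrakk>a \<in> G m; b \<in> G l\<rbrakk> \<Longrightarrow> a \<otimes> b \<in> G (m + l)"
    and decomposition: "x \<in> carrier R \<Longrightarrow>
      \<exists>!c. (\<forall>m. c m \<in> G m) \<and> finite {m. c m \<noteq> \<zero>} \<and> x = finsum R c {m. c m \<noteq> \<zero>}"
    and connected: "subfield (G 0) R"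

definition irrelevant_ideal :: "('a, 'c) ring_scheme \<Rightarrow> (nat \<Rightarrow> 'a set) \<Rightarrow> 'a set" where
  "irrelevant_ideal R G = Idl\<^bsub>R\<^esub> (\<Union>m\<in>{0<..}. G m)"

text \<open>The ground field as a module over \<open>R\<close>, via \<open>R \<longrightarrow> R Quot irrelevant_ideal R G\<close>.\<close>

definition residue_module ::
  "('a, 'c) ring_scheme \<Rightarrow> (nat \<Rightarrow> 'a set) \<Rightarrow> ('a, 'a set) module" where
  "residue_module R G = (let Q = R Quot irrelevant_ideal R G in
    \<lparr>carrier = carrier Q, monoid.mult = monoid.mult Q, one = one Q, zero = zero Q, add = add Q,
     module.smult = (\<lambda>a x. (irrelevant_ideal R G +>\<^bsub>R\<^esub> a) \<otimes>\<^bsub>Q\<^esub> x)\<rparr>)"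

definition module_homs ::
  "('a, 'c) ring_scheme \<Rightarrow> ('a, 'm) module \<Rightarrow> ('a, 'n) module \<Rightarrow> ('m \<Rightarrow> 'n) set" where
  "module_homs R M N = {f \<in> carrier M \<rightarrow> carrier N.
     (\<forall>x\<in>carrier M. \<forall>y\<in>carrier M. f (x \<oplus>\<^bsub>M\<^esub> y) = f x \<oplus>\<^bsub>N\<^esub> f y) \<and>
     (\<forall>a\<in>carrier R. \<forall>x\<in>carrier M. f (a \<odot>\<^bsub>M\<^esub> x) = a \<odot>\<^bsub>N\<^esub> f x)}"

text \<open>The fields \<open>mult\<close> and \<open>one\<close> are inherited from the ring record and have no meaning
  for a module.\<close>

definition free_module :: "('a, 'c) ring_scheme \<Rightarrow> 'b set \<Rightarrow> ('a, 'b \<Rightarrow> 'a) module" where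
  "free_module R B =
    \<lparr>carrier = {u \<in> B \<rightarrow>\<^sub>E carrier R. finite {b \<in> B. u b \<noteq> \<zero>\<^bsub>R\<^esub>}},
     monoid.mult = undefined, one = undefined,
     zero = (\<lambda>b\<in>B. \<zero>\<^bsub>R\<^esub>),
     add = (\<lambda>u v. \<lambda>b\<in>B. u b \<oplus>\<^bsub>R\<^esub> v b),
     module.smult = (\<lambda>a u. \<lambda>b\<in>B. a \<otimes>\<^bsub>R\<^esub> u b)\<rparr>"

text \<open>The degree \<open>j\<close> part of the free module with basis \<open>B\<close>, where the basis element \<open>b\<close>
  is placed in degree \<open>e b\<close>, i.e. of the direct sum of the shifts \<open>R(- e b)\<close>.\<close>

definition free_degree ::
  "('a, 'c) ring_scheme \<Rightarrow> (nat \<Rightarrow> 'a set) \<Rightarrow> 'b set \<Rightarrow> ('b \<Rightarrow> nat) \<Rightarrow> nat \<Rightarrow> ('b \<Rightarrow> 'a) set" where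
  "free_degree R G B e j = {u \<in> carrier (free_module R B).
     \<forall>b\<in>B. if e b \<le> j then u b \<in> G (j - e b) else u b = \<zero>\<^bsub>R\<^esub>}"

text \<open>A resolution
  \<open>\<dots> \<longrightarrow> F 2 \<longrightarrow> F 1 \<longrightarrow> F 0 \<longrightarrow> k \<longrightarrow> 0\<close> of \<open>k = residue_module R G\<close>, concentrated in degree \<open>0\<close>,
  by graded free modules: \<open>F i = free_module R (B i)\<close> with basis degrees \<open>e i\<close>,
  differentials \<open>d i : F (i + 1) \<longrightarrow> F i\<close> and augmentation \<open>\<epsilon>\<close>, all homogeneous of degree \<open>0\<close>.
  Exactness of a complex of graded modules is exactness in every degree.\<close>

locale graded_free_resolution = graded_algebra R G
  for R :: "('a, 'c) ring_scheme" (structure) and G :: "nat \<Rightarrow> 'a set" +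
  fixes B :: "nat \<Rightarrow> 'b set" and e :: "nat \<Rightarrow> 'b \<Rightarrow> nat"
    and d :: "nat \<Rightarrow> ('b \<Rightarrow> 'a) \<Rightarrow> ('b \<Rightarrow> 'a)" and \<epsilon> :: "('b \<Rightarrow> 'a) \<Rightarrow> 'a set"
  assumes d_hom: "d i \<in> module_homs R (free_module R (B (Suc i))) (free_module R (B i))"
    and d_degree: "d i ` free_degree R G (B (Suc i)) (e (Suc i)) j \<subseteq> free_degree R G (B i) (e i) j"
    and \<epsilon>_hom: "\<epsilon> \<in> module_homs R (free_module R (B 0)) (residue_module R G)"
    and \<epsilon>_degree: "0 < j \<Longrightarrow> \<epsilon> ` free_degree R G (B 0) (e 0) j \<subseteq> {\<zero>\<^bsub>residue_module R G\<^esub>}"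
    and \<epsilon>_surj: "\<epsilon> ` free_degree R G (B 0) (e 0) 0 = carrier (residue_module R G)"
    and exact_0: "{u \<in> free_degree R G (B 0) (e 0) j. \<epsilon> u = \<zero>\<^bsub>residue_module R G\<^esub>}
      = d 0 ` free_degree R G (B 1) (e 1) j"
    and exact_Suc: "{u \<in> free_degree R G (B (Suc i)) (e (Suc i)) j. d i u = \<zero>\<^bsub>free_module R (B i)\<^esub>}
      = d (Suc i) ` free_degree R G (B (Suc (Suc i))) (e (Suc (Suc i))) j"

text \<open>For a graded free resolution \<open>F\<close> of \<open>k\<close> as above, with \<open>R\<^sub>+ = irrelevant_ideal R G\<close>,
  the complex computing Tor is \<open>F i \<otimes>\<^sub>R k = F i / R\<^sub>+ F i\<close>, and \<open>R\<^sub>+ F i\<close> consists of the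
  vectors with all coordinates in \<open>R\<^sub>+\<close>.  The group \<open>Tor i j\<close> is the degree \<open>j\<close> part of its
  homology at \<open>i\<close>, that is \<open>tor_cycles\<close> modulo \<open>tor_boundaries\<close>; here cycles and boundaries
  are represented by their preimages in \<open>F i\<close>.\<close>

definition irrelevant_submodule ::
  "('a, 'c) ring_scheme \<Rightarrow> (nat \<Rightarrow> 'a set) \<Rightarrow> 'b set \<Rightarrow> ('b \<Rightarrow> 'a) set" where
  "irrelevant_submodule R G B =
     {u \<in> carrier (free_module R B). \<forall>b\<in>B. u b \<in> irrelevant_ideal R G}"

definition tor_cycles ::
  "('a, 'c) ring_scheme \<Rightarrow> (nat \<Rightarrow> 'a set) \<Rightarrow> (nat \<Rightarrow> 'b set) \<Rightarrow> (nat \<Rightarrow> 'b \<Rightarrow> nat) \<Rightarrow>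
    (nat \<Rightarrow> ('b \<Rightarrow> 'a) \<Rightarrow> ('b \<Rightarrow> 'a)) \<Rightarrow> nat \<Rightarrow> nat \<Rightarrow> ('b \<Rightarrow> 'a) set" where
  "tor_cycles R G B e d i j = {u \<in> free_degree R G (B i) (e i) j.
     case i of 0 \<Rightarrow> True | Suc l \<Rightarrow> d l u \<in> irrelevant_submodule R G (B l)}"

definition tor_boundaries ::
  "('a, 'c) ring_scheme \<Rightarrow> (nat \<Rightarrow> 'a set) \<Rightarrow> (nat \<Rightarrow> 'b set) \<Rightarrow> (nat \<Rightarrow> 'b \<Rightarrow> nat) \<Rightarrow>
    (nat \<Rightarrow> ('b \<Rightarrow> 'a) \<Rightarrow> ('b \<Rightarrow> 'a)) \<Rightarrow> nat \<Rightarrow> nat \<Rightarrow> ('b \<Rightarrow> 'a) set" where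
  "tor_boundaries R G B e d i j = {d i v \<oplus>\<^bsub>free_module R (B i)\<^esub> w | v w.
     v \<in> free_degree R G (B (Suc i)) (e (Suc i)) j \<and>
     w \<in> free_degree R G (B i) (e i) j \<inter> irrelevant_submodule R G (B i)}"

text \<open>Vanishing of \<open>Tor i j\<close>, computed by an arbitrary graded free resolution.  The resolutions
  are those with bases inside the type \<open>'a list\<close>; this is large enough for resolutions to exist
  over every connected graded algebra, see \<open>graded_free_resolution_exists\<close> below.\<close>

definition tor_vanishes :: "('a, 'c) ring_scheme \<Rightarrow> (nat \<Rightarrow> 'a set) \<Rightarrow> nat \<Rightarrow> nat \<Rightarrow> bool" where
  "tor_vanishes R G i j \<longleftrightarrow>
    (\<forall>(B :: nat \<Rightarrow> 'a list set) e d \<epsilon>. graded_free_resolution R G B e d \<epsilon> \<longrightarrow>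
      tor_cycles R G B e d i j = tor_boundaries R G B e d i j)"

definition koszul :: "('a, 'c) ring_scheme \<Rightarrow> (nat \<Rightarrow> 'a set) \<Rightarrow> bool" where
  "koszul R G \<longleftrightarrow> graded_algebra R G \<and> (\<forall>i j. i \<noteq> j \<longrightarrow> tor_vanishes R G i j)"

text \<open>With \<open>n + 1 = CARD('n)\<close>, the points of projective \<open>n\<close>-space over \<open>'k\<close> are the lines
  through the origin in \<open>'k ^ 'n\<close>.\<close>

definition proj_space :: "('k::field ^ 'n::finite) set set" where
  "proj_space = {vec.span {v} | v. v \<noteq> 0}"

definition proj_independent :: "('k::field ^ 'n::finite) set set \<Rightarrow> bool" where
  "proj_independent T \<longleftrightarrow>
    (\<exists>r. (\<forall>p\<in>T. r p \<in> p \<and> r p \<noteq> 0) \<and> vec.independent (r ` T))"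

definition proj_span :: "('k::field ^ 'n::finite) set set \<Rightarrow> ('k ^ 'n) set set" where
  "proj_span T = {p \<in> proj_space. p \<subseteq> vec.span (\<Union>T)}"

type_synonym ('k, 'n) mpoly = "('n \<Rightarrow>\<^sub>0 nat) \<Rightarrow>\<^sub>0 'k"

definition poly_eval :: "('k::field, 'n::finite) mpoly \<Rightarrow> 'k ^ 'n \<Rightarrow> 'k" where
  "poly_eval f v = (\<Sum>t\<in>Poly_Mapping.keys f. Poly_Mapping.lookup f t * (\<Prod>i\<in>UNIV. (v $ i) ^ Poly_Mapping.lookup t i))"

definition homogeneous :: "nat \<Rightarrow> ('k::field, 'n::finite) mpoly \<Rightarrow> bool" where
  "homogeneous m f \<longleftrightarrow> (\<forall>t\<in>Poly_Mapping.keys f. (\<Sum>i\<in>UNIV. Poly_Mapping.lookup t i) = m)"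

definition polynomial_ring :: "('k::field, 'n::finite) mpoly ring" where
  "polynomial_ring = \<lparr>carrier = UNIV, monoid.mult = (*), one = 1, zero = 0, add = (+)\<rparr>"

text \<open>For \<open>S = {}\<close> every polynomial vanishes on \<open>S\<close>; the convention that the coordinate ring
  of the empty set is the ground field amounts to taking the ideal generated by the
  homogeneous polynomials of positive degree instead.\<close>

definition vanishing_ideal ::
  "('k::field ^ 'n::finite) set set \<Rightarrow> ('k, 'n) mpoly set" where
  "vanishing_ideal S = Idl\<^bsub>polynomial_ring\<^esub>
     (if S = {} then {f. \<exists>m>0. homogeneous m f}
      else {f. (\<exists>m. homogeneous m f) \<and> (\<forall>p\<in>S. \<forall>v\<in>p. poly_eval f v = 0)})"

definition coordinate_ring ::
  "('k::field ^ 'n::finite) set set \<Rightarrow> ('k, 'n) mpoly set ring" where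
  "coordinate_ring S = polynomial_ring Quot vanishing_ideal S"

definition coordinate_degree ::
  "('k::field ^ 'n::finite) set set \<Rightarrow> nat \<Rightarrow> ('k, 'n) mpoly set set" where
  "coordinate_degree S m =
     (\<lambda>f. vanishing_ideal S +>\<^bsub>polynomial_ring\<^esub> f) ` {f. homogeneous m f}"

definition koszul_set :: "('k::field ^ 'n::finite) set set \<Rightarrow> bool" where
  "koszul_set S \<longleftrightarrow> koszul (coordinate_ring S) (coordinate_degree S)"

text \<open>Existence of graded free resolutions with bases in \<open>'a list\<close>.  Each kernel is covered by the
  free module on all its homogeneous elements; these finitely supported vectors are encoded
  injectively as lists over \<open>'a\<close>.\<close>

definition encode_pair :: "'a \<Rightarrow> 'a \<Rightarrow> 'a list \<times> 'a \<Rightarrow> 'a list" where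
  "encode_pair z s p = concat (map (\<lambda>a. [s, a]) (fst p)) @ [z, snd p]"

lemma encode_pair_append_inject:
  assumes "z \<noteq> s" "encode_pair z s (l, x) @ r = encode_pair z s (l', x') @ r'"
  shows "l = l' \<and> x = x' \<and> r = r'"
  using assms(2)
proof (induction l arbitrary: l')
  case Nil
  then show ?case using assms(1) by (cases l') (auto simp: encode_pair_def)
next
  case (Cons a l)
  then show ?case using assms(1) by (cases l') (auto simp: encode_pair_def)
qed

lemma concat_encode_pair_inject:
  assumes "z \<noteq> s" "concat (map (encode_pair z s) ps) = concat (map (encode_pair z s) qs)"
  shows "ps = qs"
  using assms(2)
proof (induction ps arbitrary: qs)
  case Nil
  then show ?case by (cases qs) (auto simp: encode_pair_def)
next
  case (Cons p ps)
  from Cons.prems obtain q qs' where qs: "qs = q # qs'"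
    by (cases qs) (auto simp: encode_pair_def)
  have "fst p = fst q \<and> snd p = snd q \<and>
      concat (map (encode_pair z s) ps) = concat (map (encode_pair z s) qs')"
    using Cons.prems assms(1)
    by (intro encode_pair_append_inject[of z s]) (auto simp: qs)
  then show ?case using Cons.IH qs by (auto simp: prod_eq_iff)
qed

lemma replicate_append_inject:
  assumes "z \<noteq> s" "replicate m s @ z # l = replicate n s @ z # l'"
  shows "m = n \<and> l = l'"
  using assms(2)
proof (induction m arbitrary: n)
  case 0
  then show ?case using assms(1) by (cases n) auto
next
  case (Suc m)
  then show ?case using assms(1) by (cases n) auto
qed

context graded_algebra
begin

lemma one_in_degree: "\<one> \<in> G 0"
proof -
  interpret subfield "G 0" R by (rule connected)
  show ?thesis by (rule one_closed)
qed

lemma zero_neq_one: "\<zero> \<noteq> \<one>"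
proof -
  interpret subfield "G 0" R by (rule connected)
  show ?thesis using sub_one_not_zero by metis
qed

lemma zero_in_degree: "\<zero> \<in> G m"
  by (rule additive_subgroup.zero_closed[OF degree_subgroup])

lemma degree_closed: "a \<in> G m \<Longrightarrow> a \<in> carrier R"
  using additive_subgroup.a_subset[OF degree_subgroup] by blast

lemma degree_add: "a \<in> G m \<Longrightarrow> b \<in> G m \<Longrightarrow> a \<oplus> b \<in> G m"
  by (rule additive_subgroup.a_closed[OF degree_subgroup])

lemma free_code_exists:
  "\<exists>c :: nat \<times> ('a list \<Rightarrow> 'a) \<Rightarrow> 'a list. inj_on c (UNIV \<times> carrier (free_module R B))"
proof -
  define ps where "ps u = (SOME ps. set ps = {(b, u b) | b. b \<in> B \<and> u b \<noteq> \<zero>})" for u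
  have ps: "set (ps u) = {(b, u b) | b. b \<in> B \<and> u b \<noteq> \<zero>}"
    if "u \<in> carrier (free_module R B)" for u
  proof -
    have "finite ((\<lambda>b. (b, u b)) ` {b \<in> B. u b \<noteq> \<zero>})"
      using that by (simp add: free_module_def)
    also have "(\<lambda>b. (b, u b)) ` {b \<in> B. u b \<noteq> \<zero>} = {(b, u b) | b. b \<in> B \<and> u b \<noteq> \<zero>}"
      by auto
    finally show ?thesis unfolding ps_def by (metis (mono_tags, lifting) finite_list someI_ex)
  qed
  define c where "c x = replicate (fst x) \<one> @ \<zero> # concat (map (encode_pair \<zero> \<one>) (ps (snd x)))"
    for x :: "nat \<times> ('a list \<Rightarrow> 'a)"
  have "inj_on c (UNIV \<times> carrier (free_module R B))"
  proof (rule inj_onI, clarify)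
    fix m u n v
    assume u: "u \<in> carrier (free_module R B)" and v: "v \<in> carrier (free_module R B)"
      and eq: "c (m, u) = c (n, v)"
    have "m = n \<and> concat (map (encode_pair \<zero> \<one>) (ps u)) = concat (map (encode_pair \<zero> \<one>) (ps v))"
      using eq by (intro replicate_append_inject[OF zero_neq_one]) (simp add: c_def)
    then have mn: "m = n" and "ps u = ps v"
      using concat_encode_pair_inject[OF zero_neq_one] by auto
    then have *: "{(b, u b) | b. b \<in> B \<and> u b \<noteq> \<zero>} = {(b, v b) | b. b \<in> B \<and> v b \<noteq> \<zero>}"
      using ps[OF u] ps[OF v] by simp
    have "u b = v b" if "b \<in> B" for b
    proof -
      have "(b, y) \<in> {(b, u b) | b. b \<in> B \<and> u b \<noteq> \<zero>} \<longleftrightarrow>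
          (b, y) \<in> {(b, v b) | b. b \<in> B \<and> v b \<noteq> \<zero>}" for y
        by (simp only: *)
      then have "y = u b \<and> u b \<noteq> \<zero> \<longleftrightarrow> y = v b \<and> v b \<noteq> \<zero>" for y
        using \<open>b \<in> B\<close> by simp
      then show ?thesis by metis
    qed
    moreover have "u \<in> extensional B" "v \<in> extensional B"
      using u v by (auto simp: free_module_def PiE_def)
    ultimately show "m = n \<and> u = v" using mn by (auto intro: extensionalityI)
  qed
  then show ?thesis by blast
qed

lemma free_cover_exists:
  fixes B :: "'a list set"
  assumes K: "\<And>j. K j \<subseteq> free_degree R G B e j"
    and K_zero: "\<And>j. \<zero>\<^bsub>free_module R B\<^esub> \<in> K j"
    and K_add: "\<And>j u v. u \<in> K j \<Longrightarrow> v \<in> K j \<Longrightarrow> u \<oplus>\<^bsub>free_module R B\<^esub> v \<in> K j"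
    and K_smult: "\<And>j m a u. a \<in> G m \<Longrightarrow> u \<in> K j \<Longrightarrow> a \<odot>\<^bsub>free_module R B\<^esub> u \<in> K (m + j)"
  shows "\<exists>(B' :: 'a list set) e' d'. d' \<in> module_homs R (free_module R B') (free_module R B) \<and>
    (\<forall>j. d' ` free_degree R G B' e' j = K j)"
proof -
  obtain c :: "nat \<times> ('a list \<Rightarrow> 'a) \<Rightarrow> 'a list"
    where c: "inj_on c (UNIV \<times> carrier (free_module R B))"
    using free_code_exists by blast
  define D where "D = {(j, h). h \<in> K j}"
  have K_carrier: "h \<in> carrier (free_module R B)" if "h \<in> K j" for h j
    using K[of j] that by (auto simp: free_degree_def)
  have c: "inj_on c D"
    using c by (rule inj_on_subset) (auto simp: D_def dest: K_carrier)
  define B' where "B' = c ` D"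
  define e' where "e' b = fst (inv_into D c b)" for b
  define \<phi> where "\<phi> b = snd (inv_into D c b)" for b
  have \<phi>_K: "\<phi> h \<in> K (e' h)" if "h \<in> B'" for h
    using inv_into_into[of h c D] that by (auto simp: B'_def D_def \<phi>_def e'_def split: prod.splits)
  have \<phi>_carrier: "\<phi> h \<in> carrier (free_module R B)" if "h \<in> B'" for h
    using K_carrier[OF \<phi>_K[OF that]] .
  have \<phi>_closed [simp]: "\<phi> h b \<in> carrier R" if "h \<in> B'" "b \<in> B" for h b
    using \<phi>_carrier[OF that(1)] that(2) by (auto simp: free_module_def)
  define supp where "supp u = {b \<in> B'. u b \<noteq> \<zero>}" for u
  define comb where "comb T u = (\<lambda>b\<in>B. \<Oplus>h\<in>T. u h \<otimes> \<phi> h b)" for T and u :: "'a list \<Rightarrow> 'a"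
  define d' where "d' u = comb (supp u) u" for u
  have u_closed [simp]: "u h \<in> carrier R" if "u \<in> carrier (free_module R B')" "h \<in> B'" for u h
    using that by (auto simp: free_module_def)
  have fin: "finite (supp u)" if "u \<in> carrier (free_module R B')" for u
    using that by (auto simp: free_module_def supp_def)
  have d'_eq: "d' u = comb T u"
    if u: "u \<in> carrier (free_module R B')" and T: "finite T" "supp u \<subseteq> T" "T \<subseteq> B'" for u T
    unfolding d'_def comb_def
  proof (rule restrict_ext)
    fix b assume b: "b \<in> B"
    show "(\<Oplus>h\<in>supp u. u h \<otimes> \<phi> h b) = (\<Oplus>h\<in>T. u h \<otimes> \<phi> h b)"
      using T u b
      by (intro add.finprod_mono_neutral_cong_left) (auto simp: supp_def)
  qed
  have comb_carrier: "comb T u \<in> carrier (free_module R B)"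
    if u: "u \<in> carrier (free_module R B')" and T: "finite T" "T \<subseteq> B'" for u T
  proof -
    have "{b \<in> B. comb T u b \<noteq> \<zero>} \<subseteq> (\<Union>h\<in>T. {b \<in> B. \<phi> h b \<noteq> \<zero>})"
    proof (rule subsetI, rule ccontr)
      fix b assume b: "b \<in> {b \<in> B. comb T u b \<noteq> \<zero>}" "b \<notin> (\<Union>h\<in>T. {b \<in> B. \<phi> h b \<noteq> \<zero>})"
      have "(\<Oplus>h\<in>T. u h \<otimes> \<phi> h b) = (\<Oplus>h\<in>T. \<zero>)"
        using b T u by (intro add.finprod_cong') (auto simp: subset_iff)
      then show False using b by (auto simp: comb_def)
    qed
    moreover have "finite (\<Union>h\<in>T. {b \<in> B. \<phi> h b \<noteq> \<zero>})"
      using T \<phi>_carrier by (auto simp: free_module_def)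
    ultimately have "finite {b \<in> B. comb T u b \<noteq> \<zero>}" by (rule finite_subset)
    moreover have "comb T u \<in> B \<rightarrow>\<^sub>E carrier R"
      using u T by (auto simp: comb_def intro!: finsum_closed)
    ultimately show ?thesis by (simp add: free_module_def)
  qed
  have hom: "d' \<in> module_homs R (free_module R B') (free_module R B)"
    unfolding module_homs_def
  proof (intro CollectI conjI ballI)
    show "d' \<in> carrier (free_module R B') \<rightarrow> carrier (free_module R B)"
      using comb_carrier fin by (auto simp: d'_def supp_def)
  next
    fix u v assume u: "u \<in> carrier (free_module R B')" and v: "v \<in> carrier (free_module R B')"
    let ?w = "u \<oplus>\<^bsub>free_module R B'\<^esub> v" and ?T = "supp u \<union> supp v"
    have T: "finite ?T" "?T \<subseteq> B'" using fin u v by (auto simp: supp_def)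
    have "supp ?w \<subseteq> ?T" by (auto simp: supp_def free_module_def)
    moreover have w: "?w \<in> carrier (free_module R B')"
      using u v calculation T finite_subset[of "supp ?w" ?T]
      by (auto simp: free_module_def supp_def)
    ultimately have "d' ?w = comb ?T ?w" using T by (intro d'_eq) auto
    also have "\<dots> = comb ?T u \<oplus>\<^bsub>free_module R B\<^esub> comb ?T v"
    proof -
      have "(\<Oplus>h\<in>?T. ?w h \<otimes> \<phi> h b) = (\<Oplus>h\<in>?T. u h \<otimes> \<phi> h b) \<oplus> (\<Oplus>h\<in>?T. v h \<otimes> \<phi> h b)"
        if b: "b \<in> B" for b
      proof -
        have "(\<Oplus>h\<in>?T. ?w h \<otimes> \<phi> h b) = (\<Oplus>h\<in>?T. u h \<otimes> \<phi> h b \<oplus> v h \<otimes> \<phi> h b)"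
        proof (rule add.finprod_cong')
          fix h assume "h \<in> ?T"
          then have "h \<in> B'" using T by auto
          then show "?w h \<otimes> \<phi> h b = u h \<otimes> \<phi> h b \<oplus> v h \<otimes> \<phi> h b"
            using u v b u_closed[OF u] u_closed[OF v]
            by (simp add: free_module_def l_distr)
        qed (use u v b T in auto)
        also have "\<dots> = (\<Oplus>h\<in>?T. u h \<otimes> \<phi> h b) \<oplus> (\<Oplus>h\<in>?T. v h \<otimes> \<phi> h b)"
          using u v b T by (intro finsum_addf) (auto simp: subset_iff)
        finally show ?thesis .
      qed
      then show ?thesis by (auto simp: comb_def free_module_def fun_eq_iff)
    qed
    also have "\<dots> = d' u \<oplus>\<^bsub>free_module R B\<^esub> d' v"
      using d'_eq[OF u T(1) _ T(2)] d'_eq[OF v T(1) _ T(2)] by simp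
    finally show "d' ?w = d' u \<oplus>\<^bsub>free_module R B\<^esub> d' v" .
  next
    fix a u assume a: "a \<in> carrier R" and u: "u \<in> carrier (free_module R B')"
    let ?w = "a \<odot>\<^bsub>free_module R B'\<^esub> u"
    have T: "finite (supp u)" "supp u \<subseteq> B'" using fin u by (auto simp: supp_def)
    have "supp ?w \<subseteq> supp u" using a by (auto simp: supp_def free_module_def)
    moreover have w: "?w \<in> carrier (free_module R B')"
      using a u calculation T finite_subset[of "supp ?w" "supp u"]
      by (auto simp: free_module_def supp_def)
    ultimately have "d' ?w = comb (supp u) ?w" using T by (intro d'_eq) auto
    also have "\<dots> = a \<odot>\<^bsub>free_module R B\<^esub> comb (supp u) u"
    proof -
      have "(\<Oplus>h\<in>supp u. ?w h \<otimes> \<phi> h b) = a \<otimes> (\<Oplus>h\<in>supp u. u h \<otimes> \<phi> h b)"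
        if b: "b \<in> B" for b
      proof -
        have "(\<Oplus>h\<in>supp u. ?w h \<otimes> \<phi> h b) = (\<Oplus>h\<in>supp u. a \<otimes> (u h \<otimes> \<phi> h b))"
        proof (rule add.finprod_cong')
          fix h assume "h \<in> supp u"
          then have "h \<in> B'" using T by auto
          then show "?w h \<otimes> \<phi> h b = a \<otimes> (u h \<otimes> \<phi> h b)"
            using a u b u_closed[OF u] by (simp add: free_module_def m_assoc)
        qed (use a u b T in auto)
        also have "\<dots> = a \<otimes> (\<Oplus>h\<in>supp u. u h \<otimes> \<phi> h b)"
          using a u b T by (intro finsum_rdistr[symmetric]) (auto simp: subset_iff)
        finally show ?thesis .
      qed
      then show ?thesis by (auto simp: comb_def free_module_def fun_eq_iff)
    qed
    finally show "d' ?w = a \<odot>\<^bsub>free_module R B\<^esub> d' u" by (simp add: d'_def)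
  qed
  have comb_K: "comb T u \<in> K j"
    if u: "u \<in> free_degree R G B' e' j" and "finite T" "T \<subseteq> B'" for T u j
    using that(2,3)
  proof (induction T rule: finite_induct)
    case empty
    have "comb {} u = \<zero>\<^bsub>free_module R B\<^esub>" by (simp add: comb_def free_module_def)
    then show ?case using K_zero by simp
  next
    case (insert h T)
    have uc: "u \<in> carrier (free_module R B')" using u by (simp add: free_degree_def)
    have h: "h \<in> B'" using insert by simp
    have "u h \<odot>\<^bsub>free_module R B\<^esub> \<phi> h \<in> K j"
    proof (cases "e' h \<le> j")
      case True
      then have "u h \<in> G (j - e' h)" using u h by (auto simp: free_degree_def)
      from K_smult[OF this \<phi>_K[OF h]] True show ?thesis by simp
    next
      case False
      then have "u h = \<zero>" using u h by (auto simp: free_degree_def)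
      then have "u h \<odot>\<^bsub>free_module R B\<^esub> \<phi> h = \<zero>\<^bsub>free_module R B\<^esub>"
        using h by (auto simp: free_module_def fun_eq_iff)
      then show ?thesis using K_zero by simp
    qed
    moreover have "comb (insert h T) u = (u h \<odot>\<^bsub>free_module R B\<^esub> \<phi> h) \<oplus>\<^bsub>free_module R B\<^esub> comb T u"
    proof -
      have "(\<Oplus>h\<in>insert h T. u h \<otimes> \<phi> h b) = u h \<otimes> \<phi> h b \<oplus> (\<Oplus>h\<in>T. u h \<otimes> \<phi> h b)"
        if "b \<in> B" for b
        using that insert uc h by (intro finsum_insert) (auto simp: subset_iff)
      then show ?thesis by (auto simp: comb_def free_module_def fun_eq_iff)
    qed
    ultimately show ?case using insert K_add by simp
  qed
  have image: "d' ` free_degree R G B' e' j = K j" for j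
  proof (intro equalityI subsetI)
    fix x assume "x \<in> d' ` free_degree R G B' e' j"
    then obtain u where u: "u \<in> free_degree R G B' e' j" and x: "x = d' u" by blast
    have "finite (supp u)" "supp u \<subseteq> B'"
      using fin u by (auto simp: free_degree_def supp_def)
    then show "x \<in> K j" unfolding x d'_def by (rule comb_K[OF u])
  next
    fix h assume h: "h \<in> K j"
    define p where "p = c (j, h)"
    have p: "p \<in> B'" using h by (auto simp: p_def B'_def D_def)
    have inv: "inv_into D c p = (j, h)"
      unfolding p_def using c h by (intro inv_into_f_f) (auto simp: D_def)
    define u where "u = (\<lambda>b\<in>B'. if b = p then \<one> else \<zero>)"
    have supp: "supp u = {p}"
      using p zero_neq_one by (auto simp: supp_def u_def)
    have "u \<in> carrier (free_module R B')"
      using supp by (auto simp: free_module_def u_def supp_def)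
    then have u: "u \<in> free_degree R G B' e' j"
      using inv one_in_degree zero_in_degree
      by (auto simp: free_degree_def u_def e'_def)
    have hc: "h \<in> B \<rightarrow>\<^sub>E carrier R" using K_carrier[OF h] by (simp add: free_module_def)
    have "d' u = (\<lambda>b\<in>B. h b)"
      unfolding d'_def supp comb_def
    proof (rule restrict_ext)
      fix b assume b: "b \<in> B"
      have "h b \<in> carrier R" using hc b by auto
      then show "(\<Oplus>q\<in>{p}. u q \<otimes> \<phi> q b) = h b"
        using p inv by (simp add: u_def \<phi>_def)
    qed
    also have "\<dots> = h" using hc by (auto simp: PiE_def extensional_def fun_eq_iff)
    finally show "h \<in> d' ` free_degree R G B' e' j" using u by (metis imageI)
  qed
  show ?thesis using hom image by blast
qed

lemma kernel_closed:
  fixes e :: "'x \<Rightarrow> nat"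
  assumes f: "f \<in> module_homs R (free_module R B) N"
    and N_null: "\<And>y. y \<in> carrier N \<Longrightarrow> \<zero> \<odot>\<^bsub>N\<^esub> y = \<zero>\<^bsub>N\<^esub>"
    and N_add: "\<zero>\<^bsub>N\<^esub> \<oplus>\<^bsub>N\<^esub> \<zero>\<^bsub>N\<^esub> = \<zero>\<^bsub>N\<^esub>"
    and N_smult: "\<And>a. a \<in> carrier R \<Longrightarrow> a \<odot>\<^bsub>N\<^esub> \<zero>\<^bsub>N\<^esub> = \<zero>\<^bsub>N\<^esub>"
  defines "K \<equiv> \<lambda>j. {u \<in> free_degree R G B e j. f u = \<zero>\<^bsub>N\<^esub>}"
  shows "\<zero>\<^bsub>free_module R B\<^esub> \<in> K j"
    and "u \<in> K j \<Longrightarrow> v \<in> K j \<Longrightarrow> u \<oplus>\<^bsub>free_module R B\<^esub> v \<in> K j"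
    and "a \<in> G m \<Longrightarrow> u \<in> K j \<Longrightarrow> a \<odot>\<^bsub>free_module R B\<^esub> u \<in> K (m + j)"
proof -
  have zero_F: "\<zero>\<^bsub>free_module R B\<^esub> \<in> free_degree R G B e j"
    by (auto simp: free_degree_def free_module_def zero_in_degree)
  then have zero_C: "\<zero>\<^bsub>free_module R B\<^esub> \<in> carrier (free_module R B)"
    by (simp add: free_degree_def)
  have "f (\<zero> \<odot>\<^bsub>free_module R B\<^esub> \<zero>\<^bsub>free_module R B\<^esub>) = \<zero> \<odot>\<^bsub>N\<^esub> f \<zero>\<^bsub>free_module R B\<^esub>"
    using f zero_C zero_closed unfolding module_homs_def by blast
  moreover have "\<zero> \<odot>\<^bsub>free_module R B\<^esub> \<zero>\<^bsub>free_module R B\<^esub> = \<zero>\<^bsub>free_module R B\<^esub>"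
    by (auto simp: free_module_def fun_eq_iff)
  moreover have "f \<zero>\<^bsub>free_module R B\<^esub> \<in> carrier N"
    using f zero_C unfolding module_homs_def by blast
  ultimately have "f \<zero>\<^bsub>free_module R B\<^esub> = \<zero>\<^bsub>N\<^esub>" using N_null by simp
  then show "\<zero>\<^bsub>free_module R B\<^esub> \<in> K j" using zero_F by (simp add: K_def)
next
  assume u: "u \<in> K j" and v: "v \<in> K j"
  then have uv: "u \<in> carrier (free_module R B)" "v \<in> carrier (free_module R B)"
    by (simp_all add: K_def free_degree_def)
  let ?w = "u \<oplus>\<^bsub>free_module R B\<^esub> v"
  have "f ?w = f u \<oplus>\<^bsub>N\<^esub> f v" using f uv unfolding module_homs_def by blast
  then have fw: "f ?w = \<zero>\<^bsub>N\<^esub>" using u v N_add by (simp add: K_def)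
  have "{b \<in> B. ?w b \<noteq> \<zero>} \<subseteq> {b \<in> B. u b \<noteq> \<zero>} \<union> {b \<in> B. v b \<noteq> \<zero>}"
    by (auto simp: free_module_def)
  moreover have "finite ({b \<in> B. u b \<noteq> \<zero>} \<union> {b \<in> B. v b \<noteq> \<zero>})"
    using uv by (simp add: free_module_def)
  ultimately have fin: "finite {b \<in> B. ?w b \<noteq> \<zero>}" by (rule finite_subset)
  have "?w \<in> B \<rightarrow>\<^sub>E carrier R"
    using uv by (auto simp: free_module_def)
  then have wc: "?w \<in> carrier (free_module R B)" using fin by (simp add: free_module_def)
  have "if e b \<le> j then ?w b \<in> G (j - e b) else ?w b = \<zero>" if b: "b \<in> B" for b
  proof -
    have w: "?w b = u b \<oplus> v b" using b by (simp add: free_module_def)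
    have "if e b \<le> j then u b \<in> G (j - e b) else u b = \<zero>"
      "if e b \<le> j then v b \<in> G (j - e b) else v b = \<zero>"
      using u v b by (simp_all add: K_def free_degree_def)
    then show ?thesis unfolding w by (simp add: degree_add split: if_splits)
  qed
  then show "?w \<in> K j" using wc fw by (simp add: K_def free_degree_def)
next
  assume a: "a \<in> G m" and u: "u \<in> K j"
  then have uc: "u \<in> carrier (free_module R B)" and ac: "a \<in> carrier R"
    by (simp_all add: K_def free_degree_def degree_closed)
  let ?w = "a \<odot>\<^bsub>free_module R B\<^esub> u"
  have "f ?w = a \<odot>\<^bsub>N\<^esub> f u" using f uc ac unfolding module_homs_def by blast
  then have fw: "f ?w = \<zero>\<^bsub>N\<^esub>" using u ac N_smult by (simp add: K_def)
  have "{b \<in> B. ?w b \<noteq> \<zero>} \<subseteq> {b \<in> B. u b \<noteq> \<zero>}"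
    using ac by (auto simp: free_module_def)
  moreover have "finite {b \<in> B. u b \<noteq> \<zero>}"
    using uc by (simp add: free_module_def)
  ultimately have fin: "finite {b \<in> B. ?w b \<noteq> \<zero>}" by (rule finite_subset)
  have "?w \<in> B \<rightarrow>\<^sub>E carrier R"
    using uc ac by (auto simp: free_module_def)
  then have wc: "?w \<in> carrier (free_module R B)" using fin by (simp add: free_module_def)
  have "if e b \<le> m + j then ?w b \<in> G (m + j - e b) else ?w b = \<zero>" if b: "b \<in> B" for b
  proof -
    have w: "?w b = a \<otimes> u b" using b by (simp add: free_module_def)
    have ub: "if e b \<le> j then u b \<in> G (j - e b) else u b = \<zero>"
      using u b by (simp add: K_def free_degree_def)
    show ?thesis
    proof (cases "e b \<le> j")
      case True
      then have "a \<otimes> u b \<in> G (m + (j - e b))" using ub degree_mult[OF a] by metis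
      then show ?thesis using True w by simp
    next
      case False
      then show ?thesis using ub w ac zero_in_degree by simp
    qed
  qed
  then show "?w \<in> K (m + j)" using wc fw by (simp add: K_def free_degree_def)
qed

theorem graded_free_resolution_exists:
  "\<exists>(B :: nat \<Rightarrow> 'a list set) e d \<epsilon>. graded_free_resolution R G B e d \<epsilon>"
proof -
  let ?F = "free_module R :: 'a list set \<Rightarrow> ('a, 'a list \<Rightarrow> 'a) module"
  let ?D = "free_degree R G :: 'a list set \<Rightarrow> _"
  let ?k = "residue_module R G"
  define I where "I = irrelevant_ideal R G"
  define Q where "Q = R Quot I"
  have "(\<Union>m\<in>{0<..}. G m) \<subseteq> carrier R" using degree_closed by blast
  then have I_ideal: "ideal I R" and G_I: "\<And>m. 0 < m \<Longrightarrow> G m \<subseteq> I"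
    using genideal_ideal genideal_self unfolding I_def irrelevant_ideal_def by blast+
  interpret I: ideal I R by (rule I_ideal)
  interpret Q: cring Q unfolding Q_def by (rule I.quotient_is_cring) (rule is_cring)
  have coset_hom: "(+>) I \<in> ring_hom R Q"
    unfolding Q_def by (rule I.rcos_ring_hom)
  have zero_Q: "\<zero>\<^bsub>Q\<^esub> = I" by (simp add: Q_def FactRing_def)
  have coset_I: "I +> x = \<zero>\<^bsub>Q\<^esub>" if "x \<in> I" for x
    using I.a_rcos_const[OF that] zero_Q by simp
  have k: "carrier ?k = carrier Q" "\<zero>\<^bsub>?k\<^esub> = \<zero>\<^bsub>Q\<^esub>" "x \<oplus>\<^bsub>?k\<^esub> y = x \<oplus>\<^bsub>Q\<^esub> y"
    "a \<odot>\<^bsub>?k\<^esub> x = (I +> a) \<otimes>\<^bsub>Q\<^esub> x" for x y a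
    by (simp_all add: residue_module_def Let_def Q_def I_def)

  define B0 where "B0 = {[] :: 'a list}"
  define e0 where "e0 = (\<lambda>_ :: 'a list. 0 :: nat)"
  define \<epsilon> where "\<epsilon> u = I +> u []" for u :: "'a list \<Rightarrow> 'a"
  have D0: "u \<in> ?D B0 e0 j \<longleftrightarrow> u \<in> carrier (?F B0) \<and> u [] \<in> G j" for u j
    by (simp add: free_degree_def B0_def e0_def)
  have \<epsilon>_hom: "\<epsilon> \<in> module_homs R (?F B0) ?k"
    using ring_hom_closed[OF coset_hom] ring_hom_add[OF coset_hom] ring_hom_mult[OF coset_hom]
    by (auto simp: module_homs_def k \<epsilon>_def B0_def free_module_def PiE_def)
  have \<epsilon>_degree: "\<epsilon> ` ?D B0 e0 j \<subseteq> {\<zero>\<^bsub>?k\<^esub>}" if "0 < j" for j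
    using G_I[OF that] coset_I by (auto simp: \<epsilon>_def D0 k)
  have \<epsilon>_surj: "\<epsilon> ` ?D B0 e0 0 = carrier ?k"
  proof (intro equalityI subsetI)
    fix y assume "y \<in> \<epsilon> ` ?D B0 e0 0"
    then show "y \<in> carrier ?k" using \<epsilon>_hom by (auto simp: module_homs_def free_degree_def)
  next
    fix y assume "y \<in> carrier ?k"
    then obtain x where x: "x \<in> carrier R" and y: "y = I +> x"
      by (auto simp: k Q_def FactRing_def A_RCOSETS_def')
    obtain c where c: "\<And>m. c m \<in> G m" and fin: "finite {m. c m \<noteq> \<zero>}"
      and sum: "x = finsum R c {m. c m \<noteq> \<zero>}"
      using decomposition[OF x] by auto
    have c_closed [simp]: "c m \<in> carrier R" for m using c degree_closed by blast
    let ?T = "{m. c m \<noteq> \<zero>} - {0}"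
    have "x = finsum R c (insert 0 ?T)"
      unfolding sum using fin by (intro add.finprod_mono_neutral_cong_left) auto
    also have "\<dots> = c 0 \<oplus> finsum R c ?T" using fin by (intro finsum_insert) auto
    finally have x_eq: "x = c 0 \<oplus> finsum R c ?T" .
    have "finsum R c T \<in> I" if "finite T" "0 \<notin> T" for T
      using that
    proof (induction T rule: finite_induct)
      case empty
      then show ?case by simp
    next
      case (insert m T)
      have "finsum R c (insert m T) = c m \<oplus> finsum R c T"
        using insert by (intro finsum_insert) auto
      moreover have "c m \<in> I" using c[of m] G_I[of m] insert by (cases m) auto
      ultimately show ?case using insert by simp
    qed
    then have rest: "finsum R c ?T \<in> I" using fin by simp
    have "y = (I +> c 0) \<oplus>\<^bsub>Q\<^esub> (I +> finsum R c ?T)"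
      unfolding y x_eq by (intro ring_hom_add[OF coset_hom]) (use rest in auto)
    also have "\<dots> = I +> c 0"
      using coset_I[OF rest] ring_hom_closed[OF coset_hom c_closed] by simp
    finally have "y = \<epsilon> (\<lambda>b\<in>B0. c 0)" by (simp add: \<epsilon>_def B0_def)
    moreover have "(\<lambda>b\<in>B0. c 0) \<in> ?D B0 e0 0"
      unfolding D0 using c[of 0] by (simp add: free_module_def B0_def)
    ultimately show "y \<in> \<epsilon> ` ?D B0 e0 0" by blast
  qed

  define P where "P = (\<lambda>(B, e, K).
    (\<forall>j. K j \<subseteq> ?D B e j) \<and> (\<forall>j. \<zero>\<^bsub>?F B\<^esub> \<in> K j) \<and>
    (\<forall>j u v. u \<in> K j \<longrightarrow> v \<in> K j \<longrightarrow> u \<oplus>\<^bsub>?F B\<^esub> v \<in> K j) \<and>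
    (\<forall>j m a u. a \<in> G m \<longrightarrow> u \<in> K j \<longrightarrow> a \<odot>\<^bsub>?F B\<^esub> u \<in> K (m + j)))"
  define S where "S = (\<lambda>(B, e :: 'a list \<Rightarrow> nat, K) (B', e', K').
    \<exists>d. d \<in> module_homs R (?F B') (?F B) \<and> (\<forall>j. d ` ?D B' e' j = K j) \<and>
      (\<forall>j. K' j = {u \<in> ?D B' e' j. d u = \<zero>\<^bsub>?F B\<^esub>}))"
  define K0 where "K0 j = {u \<in> ?D B0 e0 j. \<epsilon> u = \<zero>\<^bsub>?k\<^esub>}" for j
  have P0: "P (B0, e0, K0)"
  proof -
    have N: "\<And>y. y \<in> carrier ?k \<Longrightarrow> \<zero> \<odot>\<^bsub>?k\<^esub> y = \<zero>\<^bsub>?k\<^esub>" "\<zero>\<^bsub>?k\<^esub> \<oplus>\<^bsub>?k\<^esub> \<zero>\<^bsub>?k\<^esub> = \<zero>\<^bsub>?k\<^esub>"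
      "\<And>a. a \<in> carrier R \<Longrightarrow> a \<odot>\<^bsub>?k\<^esub> \<zero>\<^bsub>?k\<^esub> = \<zero>\<^bsub>?k\<^esub>"
      using coset_I[OF I.zero_closed] ring_hom_closed[OF coset_hom] by (simp_all add: k)
    show ?thesis
      using kernel_closed[where e = e0, OF \<epsilon>_hom N] unfolding P_def K0_def by auto
  qed
  have step: "\<exists>t. P t \<and> S s t" if s: "P s" for s
  proof -
    obtain B e K where s_eq: "s = (B, e, K)" by (cases s)
    obtain B' e' d where d: "d \<in> module_homs R (?F B') (?F B)" "\<And>j. d ` ?D B' e' j = K j"
      using free_cover_exists[of K B e] s unfolding P_def s_eq by auto
    define K' where "K' j = {u \<in> ?D B' e' j. d u = \<zero>\<^bsub>?F B\<^esub>}" for j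
    have N: "\<And>y. y \<in> carrier (?F B) \<Longrightarrow> \<zero> \<odot>\<^bsub>?F B\<^esub> y = \<zero>\<^bsub>?F B\<^esub>"
      "\<zero>\<^bsub>?F B\<^esub> \<oplus>\<^bsub>?F B\<^esub> \<zero>\<^bsub>?F B\<^esub> = \<zero>\<^bsub>?F B\<^esub>"
      "\<And>a. a \<in> carrier R \<Longrightarrow> a \<odot>\<^bsub>?F B\<^esub> \<zero>\<^bsub>?F B\<^esub> = \<zero>\<^bsub>?F B\<^esub>"
      by (auto simp: free_module_def fun_eq_iff dest: PiE_mem)
    have "P (B', e', K')"
      using kernel_closed[where e = e', OF d(1) N] unfolding P_def K'_def by auto
    moreover have "S s (B', e', K')"
      using d unfolding S_def s_eq K'_def by auto
    ultimately show ?thesis by blast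
  qed
  have "\<exists>f. \<forall>n. (P (f n) \<and> (n = 0 \<longrightarrow> f n = (B0, e0, K0))) \<and> S (f n) (f (Suc n))"
    using P0 step by (intro dependent_nat_choice) auto
  then obtain f where f: "\<And>n. P (f n)" "f 0 = (B0, e0, K0)" "\<And>n. S (f n) (f (Suc n))"
    by blast
  define B where "B n = fst (f n)" for n
  define e where "e n = fst (snd (f n))" for n
  define K where "K n = snd (snd (f n))" for n
  have f_eq: "f n = (B n, e n, K n)" for n by (simp add: B_def e_def K_def)
  define L where "L n d \<longleftrightarrow> d \<in> module_homs R (?F (B (Suc n))) (?F (B n)) \<and>
      (\<forall>j. d ` ?D (B (Suc n)) (e (Suc n)) j = K n j) \<and>
      (\<forall>j. K (Suc n) j = {u \<in> ?D (B (Suc n)) (e (Suc n)) j. d u = \<zero>\<^bsub>?F (B n)\<^esub>})" for n d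
  have "\<forall>n. \<exists>d. L n d"
  proof
    fix n
    have "S (B n, e n, K n) (B (Suc n), e (Suc n), K (Suc n))"
      using f(3)[of n] by (simp only: f_eq)
    then show "\<exists>d. L n d" unfolding S_def prod.case L_def .
  qed
  then obtain d where "\<forall>n. L n (d n)" by (rule choice[THEN exE])
  then have d: "\<And>n. d n \<in> module_homs R (?F (B (Suc n))) (?F (B n))"
    "\<And>n j. d n ` ?D (B (Suc n)) (e (Suc n)) j = K n j"
    "\<And>n j. K (Suc n) j = {u \<in> ?D (B (Suc n)) (e (Suc n)) j. d n u = \<zero>\<^bsub>?F (B n)\<^esub>}"
    unfolding L_def by blast+
  have start: "B 0 = B0" "e 0 = e0" "K 0 = K0" using f(2) by (simp_all add: B_def e_def K_def)
  have K_sub: "K n j \<subseteq> ?D (B n) (e n) j" for n j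
    using f(1)[of n] unfolding f_eq P_def by simp
  have "graded_free_resolution R G B e d \<epsilon>"
  proof unfold_locales
    show "d i \<in> module_homs R (?F (B (Suc i))) (?F (B i))" for i by (rule d(1))
    show "d i ` ?D (B (Suc i)) (e (Suc i)) j \<subseteq> ?D (B i) (e i) j" for i j
      using d(2) K_sub by simp
    show "\<epsilon> \<in> module_homs R (?F (B 0)) ?k" using \<epsilon>_hom start by simp
    show "\<epsilon> ` ?D (B 0) (e 0) j \<subseteq> {\<zero>\<^bsub>?k\<^esub>}" if "0 < j" for j
      using \<epsilon>_degree[OF that] start by simp
    show "\<epsilon> ` ?D (B 0) (e 0) 0 = carrier ?k" using \<epsilon>_surj start by simp
    show "{u \<in> ?D (B 0) (e 0) j. \<epsilon> u = \<zero>\<^bsub>?k\<^esub>} = d 0 ` ?D (B 1) (e 1) j" for j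
      using d(2)[of 0 j] start by (simp add: K0_def)
    show "{u \<in> ?D (B (Suc i)) (e (Suc i)) j. d i u = \<zero>\<^bsub>?F (B i)\<^esub>} =
        d (Suc i) ` ?D (B (Suc (Suc i))) (e (Suc (Suc i))) j" for i j
      using d(2)[of "Suc i" j] d(3)[of i j] by simp
  qed
  then show ?thesis by blast
qed

end

end

theory Submission
  imports Defs
begin

text \<open>The coordinate ring \<open>A\<close> is studied through the functions its elements define on \<open>S\<close>.  For \<open>T \<subseteq> S\<close> let
\<open>I\<^sub>T\<close> be the graded ideal of positive degree elements vanishing on \<open>T\<close>; thus \<open>I\<^sub>\<emptyset>\<close> is the irrelevant
ideal.  The proof considers these ideals for all \<open>T\<close> contained in one of the two halves \<open>S\<^sub>1\<close>, \<open>S\<^sub>2\<close>.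

Call a graded ideal filtered over a family of ideals if it is reached from \<open>0\<close> by adjoining linear
forms \<open>w\<close> one at a time such that each colon ideal \<open>K : w\<close>, with \<open>K\<close> the ideal before the step,
belongs to the family.  Each step has quotient \<open>(K + wA) / K = A / (K : w)\<close>, shifted by one degree.
If every member of a family is filtered over the family, all quotients by members have linear
resolutions: for \<open>i > 0\<close>, \<open>Tor i\<close> of \<open>A / I\<close> embeds in \<open>Tor (i - 1)\<close> of \<open>I\<close>, and \<open>I\<close> is an iterated
extension of such quotients, shifted by one degree.  If the irrelevant ideal is a member, then \<open>A\<close> is Koszul
(\<open>koszul_if_linear_filtrations\<close>).  This is a variant of the Koszul filtrations of Conca, Trung and
Valla, in which the intermediate ideals need not be members.  As \<open>Tor\<close> is the homology of
\<open>F / I F\<close> for any graded free resolution \<open>F\<close> of the ground field, the induction runs entirely inside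
one given resolution \<open>F\<close> (\<open>lift_along_filtration\<close>, \<open>homology_mod_ideal\<close>).

It remains to filter \<open>I\<^sub>T\<close> for \<open>T \<subseteq> S\<^sub>1\<close>.  Consider \<open>I\<^sub>Z\<close> for flats \<open>Z\<close>, the intersections of \<open>S\<close> with linear
subspaces, and start from \<open>Z = S\<close>, where the ideal is \<open>0\<close>.  Remove points from the spanning set of the
flat: first the points of \<open>S\<^sub>2\<close>, until \<open>S\<^sub>1\<close> is left, which is a flat since its span contains no
point of \<open>S\<^sub>2\<close>; then the points of \<open>S\<^sub>1 - T\<close>, passing through subsets of \<open>S\<^sub>1\<close>, which are flats because
\<open>S\<^sub>1\<close> is linearly independent.  When the flat shrinks from \<open>Z'\<close> to \<open>Z\<close>, the space of
linear forms grows by a single form \<open>w\<close>, which vanishes on \<open>Z\<close> and at no point of \<open>Z' - Z\<close>.  Hence the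
colon ideal is \<open>I\<^sub>D\<close> for \<open>D = Z' - Z\<close>.  The set \<open>D\<close> lies in one half and is therefore linearly independent,
so elements of \<open>A\<close> of any positive degree take arbitrary values on \<open>D\<close>, which shows that \<open>w\<close>
generates \<open>I\<^sub>Z\<close> over the ideal of \<open>Z'\<close> (\<open>linear_filtration_remove_point\<close>).
This argument works over every field, since no form in general position is chosen.\<close>

section \<open>Graded ideals acting on free modules\<close>

lemma free_module_carrier:
  "u \<in> carrier (free_module R B) \<longleftrightarrow> u \<in> B \<rightarrow>\<^sub>E carrier R \<and> finite {b \<in> B. u b \<noteq> \<zero>\<^bsub>R\<^esub>}"
  by (simp add: free_module_def)

lemma free_module_coord:
  "b \<in> B \<Longrightarrow> \<zero>\<^bsub>free_module R B\<^esub> b = \<zero>\<^bsub>R\<^esub>"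
  "b \<in> B \<Longrightarrow> (u \<oplus>\<^bsub>free_module R B\<^esub> v) b = u b \<oplus>\<^bsub>R\<^esub> v b"
  "b \<in> B \<Longrightarrow> (a \<odot>\<^bsub>free_module R B\<^esub> u) b = a \<otimes>\<^bsub>R\<^esub> u b"
  by (simp_all add: free_module_def)

lemma free_module_coord_closed: "u \<in> carrier (free_module R B) \<Longrightarrow> b \<in> B \<Longrightarrow> u b \<in> carrier R"
  by (auto simp: free_module_carrier)

lemma free_module_eqI:
  assumes "u \<in> carrier (free_module R B)" "v \<in> carrier (free_module R B)" "\<And>b. b \<in> B \<Longrightarrow> u b = v b"
  shows "u = v"
  using assms by (auto simp: free_module_carrier PiE_def intro: extensionalityI)

lemma (in cring) free_module_closed:
  shows "\<zero>\<^bsub>free_module R B\<^esub> \<in> carrier (free_module R B)"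
    and "u \<in> carrier (free_module R B) \<Longrightarrow> v \<in> carrier (free_module R B) \<Longrightarrow>
      u \<oplus>\<^bsub>free_module R B\<^esub> v \<in> carrier (free_module R B)"
    and "a \<in> carrier R \<Longrightarrow> u \<in> carrier (free_module R B) \<Longrightarrow>
      a \<odot>\<^bsub>free_module R B\<^esub> u \<in> carrier (free_module R B)"
proof -
  show "\<zero>\<^bsub>free_module R B\<^esub> \<in> carrier (free_module R B)"
    by (auto simp: free_module_def)
  show "u \<oplus>\<^bsub>free_module R B\<^esub> v \<in> carrier (free_module R B)"
    if u: "u \<in> carrier (free_module R B)" and v: "v \<in> carrier (free_module R B)"
  proof -
    have "{b \<in> B. (u \<oplus>\<^bsub>free_module R B\<^esub> v) b \<noteq> \<zero>} \<subseteq> {b \<in> B. u b \<noteq> \<zero>} \<union> {b \<in> B. v b \<noteq> \<zero>}"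
      by (auto simp: free_module_coord)
    then have "finite {b \<in> B. (u \<oplus>\<^bsub>free_module R B\<^esub> v) b \<noteq> \<zero>}"
      using u v by (auto simp: free_module_carrier intro: finite_subset)
    then show ?thesis using u v by (auto simp: free_module_def)
  qed
  show "a \<odot>\<^bsub>free_module R B\<^esub> u \<in> carrier (free_module R B)"
    if a: "a \<in> carrier R" and u: "u \<in> carrier (free_module R B)"
  proof -
    have "{b \<in> B. (a \<odot>\<^bsub>free_module R B\<^esub> u) b \<noteq> \<zero>} \<subseteq> {b \<in> B. u b \<noteq> \<zero>}"
      using a by (auto simp: free_module_coord)
    then have "finite {b \<in> B. (a \<odot>\<^bsub>free_module R B\<^esub> u) b \<noteq> \<zero>}"
      using u by (auto simp: free_module_carrier intro: finite_subset)
    then show ?thesis using a u by (auto simp: free_module_def)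
  qed
qed

lemma (in cring) free_module_is_module: "module R (free_module R B)"
proof (rule module.intro)
  let ?F = "free_module R B"
  note [simp] = free_module_closed free_module_coord
  have c [simp]: "u b \<in> carrier R" if "u \<in> carrier ?F" "b \<in> B" for u b
    using that by (rule free_module_coord_closed)
  show "cring R" by (rule is_cring)
  show "abelian_group ?F"
  proof (rule abelian_groupI)
    fix u assume u: "u \<in> carrier ?F"
    have "(\<ominus> \<one> \<odot>\<^bsub>?F\<^esub> u) \<oplus>\<^bsub>?F\<^esub> u = \<zero>\<^bsub>?F\<^esub>"
      using u by (intro free_module_eqI[of _ R B]) (auto simp: l_minus l_neg)
    then show "\<exists>y\<in>carrier ?F. y \<oplus>\<^bsub>?F\<^esub> u = \<zero>\<^bsub>?F\<^esub>" using u by (metis a_inv_closed one_closed free_module_closed(3))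
  qed (auto intro!: free_module_eqI[of _ R B] simp: a_ac)
  show "module_axioms R ?F"
    by (auto intro!: module_axioms.intro free_module_eqI[of _ R B] simp: l_distr r_distr m_assoc)
qed

lemma (in cring) module_hom_zero:
  assumes "f \<in> module_homs R (free_module R B) (free_module R B')"
  shows "f \<zero>\<^bsub>free_module R B\<^esub> = \<zero>\<^bsub>free_module R B'\<^esub>"
proof -
  interpret M: module R "free_module R B" by (rule free_module_is_module)
  interpret N: module R "free_module R B'" by (rule free_module_is_module)
  have "f (\<zero> \<odot>\<^bsub>free_module R B\<^esub> \<zero>\<^bsub>free_module R B\<^esub>) = \<zero> \<odot>\<^bsub>free_module R B'\<^esub> f \<zero>\<^bsub>free_module R B\<^esub>"
    and "f \<zero>\<^bsub>free_module R B\<^esub> \<in> carrier (free_module R B')"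
    using assms M.zero_closed zero_closed unfolding module_homs_def by blast+
  then show ?thesis by simp
qed

lemma (in cring) module_hom_minus:
  assumes f: "f \<in> module_homs R (free_module R B) (free_module R B')"
    and u: "u \<in> carrier (free_module R B)" and v: "v \<in> carrier (free_module R B)"
  shows "f (u \<ominus>\<^bsub>free_module R B\<^esub> v) = f u \<ominus>\<^bsub>free_module R B'\<^esub> f v"
proof -
  interpret M: module R "free_module R B" by (rule free_module_is_module)
  interpret N: module R "free_module R B'" by (rule free_module_is_module)
  have fc: "f x \<in> carrier (free_module R B')" if "x \<in> carrier (free_module R B)" for x
    using f that by (auto simp: module_homs_def)
  have uv: "u \<ominus>\<^bsub>free_module R B\<^esub> v \<in> carrier (free_module R B)" using u v by simp
  have "f (u \<ominus>\<^bsub>free_module R B\<^esub> v) \<oplus>\<^bsub>free_module R B'\<^esub> f v = f ((u \<ominus>\<^bsub>free_module R B\<^esub> v) \<oplus>\<^bsub>free_module R B\<^esub> v)"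
    using f uv v unfolding module_homs_def by auto
  also have "(u \<ominus>\<^bsub>free_module R B\<^esub> v) \<oplus>\<^bsub>free_module R B\<^esub> v = u"
    using u v by (simp add: M.minus_eq M.a_assoc M.l_neg)
  finally have "f u = f (u \<ominus>\<^bsub>free_module R B\<^esub> v) \<oplus>\<^bsub>free_module R B'\<^esub> f v" by simp
  then show ?thesis
    using fc[OF uv] fc[OF v] by (simp add: N.minus_eq N.a_assoc N.r_neg)
qed

lemma (in graded_algebra) degree_minus: "a \<in> G m \<Longrightarrow> \<ominus> a \<in> G m"
  using additive_subgroup.a_inv_closed[OF degree_subgroup] by blast

context graded_algebra
begin

text \<open>A homogeneous ideal is represented by the sequence of its homogeneous parts.  All elements met
below are homogeneous, so this avoids decomposing elements into their components.\<close>

definition graded_ideal :: "(nat \<Rightarrow> 'a set) \<Rightarrow> bool" where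
  "graded_ideal K \<longleftrightarrow> (\<forall>m. K m \<subseteq> G m \<and> \<zero> \<in> K m \<and> (\<forall>x\<in>K m. \<forall>y\<in>K m. x \<oplus> y \<in> K m) \<and>
     (\<forall>l. \<forall>a\<in>G l. \<forall>x\<in>K m. a \<otimes> x \<in> K (l + m)))"

lemma graded_ideal_zero: "graded_ideal K \<Longrightarrow> \<zero> \<in> K m"
  and graded_ideal_add: "graded_ideal K \<Longrightarrow> x \<in> K m \<Longrightarrow> y \<in> K m \<Longrightarrow> x \<oplus> y \<in> K m"
  and graded_ideal_mult: "graded_ideal K \<Longrightarrow> a \<in> G l \<Longrightarrow> x \<in> K m \<Longrightarrow> a \<otimes> x \<in> K (l + m)"
  and graded_ideal_degree: "graded_ideal K \<Longrightarrow> x \<in> K m \<Longrightarrow> x \<in> G m"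
  by (auto simp: graded_ideal_def)

lemma graded_ideal_closed: "graded_ideal K \<Longrightarrow> x \<in> K m \<Longrightarrow> x \<in> carrier R"
  using graded_ideal_degree degree_closed by blast

text \<open>The homogeneous parts of \<open>K + w R\<close> for a linear form \<open>w\<close>.\<close>

definition adjoin :: "(nat \<Rightarrow> 'a set) \<Rightarrow> 'a \<Rightarrow> nat \<Rightarrow> 'a set" where
  "adjoin K w m = (case m of 0 \<Rightarrow> K 0 | Suc l \<Rightarrow> {x \<oplus> w \<otimes> z | x z. x \<in> K m \<and> z \<in> G l})"

definition colon :: "(nat \<Rightarrow> 'a set) \<Rightarrow> 'a \<Rightarrow> nat \<Rightarrow> 'a set" where
  "colon K w m = {a \<in> G m. w \<otimes> a \<in> K (Suc m)}"

text \<open>The successive quotients of the filtration are cyclic, generated in degree one, and isomorphic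
up to a shift to \<open>R\<close> modulo a member of \<open>\<F>\<close>.\<close>

inductive linear_filtration :: "(nat \<Rightarrow> 'a set) set \<Rightarrow> (nat \<Rightarrow> 'a set) \<Rightarrow> bool"
  for \<F> :: "(nat \<Rightarrow> 'a set) set" where
  zero: "linear_filtration \<F> (\<lambda>m. {\<zero>})"
| adjoin: "linear_filtration \<F> K \<Longrightarrow> w \<in> G 1 \<Longrightarrow> colon K w \<in> \<F> \<Longrightarrow> linear_filtration \<F> (adjoin K w)"

lemma graded_ideal_zero_ideal: "graded_ideal (\<lambda>m. {\<zero>})"
  using degree_closed zero_in_degree by (auto simp: graded_ideal_def)

lemma graded_ideal_adjoin:
  assumes K: "graded_ideal K" and w: "w \<in> G 1"
  shows "graded_ideal (adjoin K w)"
proof -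
  have wc: "w \<in> carrier R" using w by (rule degree_closed)
  note Kc = graded_ideal_closed[OF K]
  have sub: "adjoin K w m \<subseteq> G m" for m
    using graded_ideal_degree[OF K] degree_mult[OF w] degree_add
    by (cases m) (auto simp: adjoin_def)
  have zero: "\<zero> \<in> adjoin K w m" for m
  proof (cases m)
    case (Suc l)
    have "\<zero> = \<zero> \<oplus> w \<otimes> \<zero>" using wc by simp
    then show ?thesis using Suc graded_ideal_zero[OF K] zero_in_degree by (auto simp: adjoin_def)
  qed (simp add: adjoin_def graded_ideal_zero[OF K])
  have add: "p \<oplus> q \<in> adjoin K w m" if p: "p \<in> adjoin K w m" and q: "q \<in> adjoin K w m" for p q m
  proof (cases m)
    case 0
    then show ?thesis using p q graded_ideal_add[OF K] by (simp add: adjoin_def)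
  next
    case (Suc l)
    then obtain x z y t where *: "p = x \<oplus> w \<otimes> z" "q = y \<oplus> w \<otimes> t" "x \<in> K m" "y \<in> K m" "z \<in> G l" "t \<in> G l"
      using p q by (auto simp: adjoin_def)
    have "p \<oplus> q = (x \<oplus> y) \<oplus> w \<otimes> (z \<oplus> t)"
      using * wc Kc degree_closed by (simp add: r_distr a_ac)
    then show ?thesis using * Suc graded_ideal_add[OF K *(3,4)] degree_add[OF *(5,6)]
      unfolding adjoin_def by auto
  qed
  have mult: "a \<otimes> p \<in> adjoin K w (l + m)" if a: "a \<in> G l" and p: "p \<in> adjoin K w m" for a p l m
  proof (cases m)
    case 0
    show ?thesis
    proof (cases l)
      case 0
      then show ?thesis using \<open>m = 0\<close> a p graded_ideal_mult[OF K, of a 0 p 0] by (simp add: adjoin_def)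
    next
      case (Suc i)
      have "a \<otimes> p \<in> K l" using \<open>m = 0\<close> a p graded_ideal_mult[OF K, of a l p 0] by (simp add: adjoin_def)
      moreover from this have "a \<otimes> p = a \<otimes> p \<oplus> w \<otimes> \<zero>" using Kc wc by simp
      ultimately show ?thesis using Suc \<open>m = 0\<close> zero_in_degree[of i] by (auto simp: adjoin_def)
    qed
  next
    case (Suc i)
    then obtain x z where *: "p = x \<oplus> w \<otimes> z" "x \<in> K m" "z \<in> G i" using p by (auto simp: adjoin_def)
    have "a \<otimes> p = a \<otimes> x \<oplus> w \<otimes> (a \<otimes> z)"
      using * wc a Kc degree_closed by (simp add: r_distr m_lcomm)
    moreover have "a \<otimes> x \<in> K (l + m)" "a \<otimes> z \<in> G (l + i)"
      using * a graded_ideal_mult[OF K] degree_mult by auto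
    ultimately show ?thesis using Suc by (auto simp: adjoin_def)
  qed
  show ?thesis using sub zero add mult unfolding graded_ideal_def by blast
qed

lemma linear_filtration_ideal:
  assumes "linear_filtration \<F> K"
  shows "graded_ideal K" and "K 0 = {\<zero>}"
proof -
  have "graded_ideal K \<and> K 0 = {\<zero>}" using assms
  proof induction
    case zero
    then show ?case by (simp add: graded_ideal_zero_ideal)
  next
    case (adjoin K w)
    then have "graded_ideal (adjoin K w)" by (intro graded_ideal_adjoin) auto
    moreover have "adjoin K w 0 = {\<zero>}" using adjoin by (simp add: adjoin_def)
    ultimately show ?case by blast
  qed
  then show "graded_ideal K" "K 0 = {\<zero>}" by auto
qed

text \<open>For the free module \<open>F\<close> on \<open>B\<close> this is the degree \<open>j\<close> part of \<open>K F\<close>, which consists of the vectors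
with coordinates in \<open>K\<close>.\<close>

definition ideal_times_free ::
  "(nat \<Rightarrow> 'a set) \<Rightarrow> 'b set \<Rightarrow> ('b \<Rightarrow> nat) \<Rightarrow> nat \<Rightarrow> ('b \<Rightarrow> 'a) set" where
  "ideal_times_free K B e j = {u \<in> free_degree R G B e j. \<forall>b\<in>B. e b \<le> j \<longrightarrow> u b \<in> K (j - e b)}"

lemma free_degree_closed: "u \<in> free_degree R G B e j \<Longrightarrow> u \<in> carrier (free_module R B)"
  by (simp add: free_degree_def)

lemma free_degree_eq_ideal_times_free: "free_degree R G B e j = ideal_times_free G B e j"
  by (auto simp: ideal_times_free_def free_degree_def)

lemma graded_ideal_unit: "graded_ideal G"
  using zero_in_degree degree_add degree_mult by (auto simp: graded_ideal_def)

lemma ideal_times_free_coord: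
  "u \<in> ideal_times_free K B e j \<longleftrightarrow> u \<in> carrier (free_module R B) \<and>
     (\<forall>b\<in>B. if e b \<le> j then u b \<in> K (j - e b) else u b = \<zero>)" if "graded_ideal K"
  using graded_ideal_degree[OF that] by (auto simp: ideal_times_free_def free_degree_def split: if_splits)

lemma ideal_times_free_free: "u \<in> ideal_times_free K B e j \<Longrightarrow> u \<in> free_degree R G B e j"
  by (simp add: ideal_times_free_def)

lemma ideal_times_free_zero: "graded_ideal K \<Longrightarrow> \<zero>\<^bsub>free_module R B\<^esub> \<in> ideal_times_free K B e j"
  using free_module_closed(1) by (auto simp: ideal_times_free_coord free_module_coord graded_ideal_zero)

lemma ideal_times_free_add:
  "graded_ideal K \<Longrightarrow> u \<in> ideal_times_free K B e j \<Longrightarrow> v \<in> ideal_times_free K B e j \<Longrightarrow>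
    u \<oplus>\<^bsub>free_module R B\<^esub> v \<in> ideal_times_free K B e j"
  using free_module_closed(2) by (auto simp: ideal_times_free_coord free_module_coord graded_ideal_add)

lemma free_module_uminus:
  assumes "u \<in> carrier (free_module R B)"
  shows "\<ominus>\<^bsub>free_module R B\<^esub> u = \<ominus> \<one> \<odot>\<^bsub>free_module R B\<^esub> u"
proof -
  interpret M: module R "free_module R B" by (rule free_module_is_module)
  show ?thesis using assms M.smult_l_minus[of \<one> u] by simp
qed

lemma ideal_times_free_smult:
  assumes "graded_ideal K" "a \<in> G m" "u \<in> ideal_times_free K B e j"
  shows "a \<odot>\<^bsub>free_module R B\<^esub> u \<in> ideal_times_free K B e (m + j)"
  unfolding ideal_times_free_coord[OF assms(1)]
proof (intro conjI ballI)
  have ac: "a \<in> carrier R" using assms degree_closed by blast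
  have u: "u \<in> carrier (free_module R B)" "\<And>b. b \<in> B \<Longrightarrow> if e b \<le> j then u b \<in> K (j - e b) else u b = \<zero>"
    using assms by (auto simp: ideal_times_free_coord)
  show "a \<odot>\<^bsub>free_module R B\<^esub> u \<in> carrier (free_module R B)" by (rule free_module_closed(3)[OF ac u(1)])
  fix b assume b: "b \<in> B"
  show "if e b \<le> m + j then (a \<odot>\<^bsub>free_module R B\<^esub> u) b \<in> K (m + j - e b)
    else (a \<odot>\<^bsub>free_module R B\<^esub> u) b = \<zero>"
  proof (cases "e b \<le> j")
    case True
    then show ?thesis using u(2)[OF b] graded_ideal_mult[OF assms(1,2), of "u b" "j - e b"] b
      by (simp add: free_module_coord)
  next
    case False
    then show ?thesis using u(2)[OF b] b ac graded_ideal_zero[OF assms(1)] by (simp add: free_module_coord)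
  qed
qed

lemma ideal_times_free_smult_right:
  assumes K: "graded_ideal K" and a: "a \<in> K m" and u: "u \<in> free_degree R G B e j"
  shows "a \<odot>\<^bsub>free_module R B\<^esub> u \<in> ideal_times_free K B e (m + j)"
  unfolding ideal_times_free_coord[OF K]
proof (intro conjI ballI)
  have ac: "a \<in> carrier R" using assms graded_ideal_closed by blast
  have u: "u \<in> carrier (free_module R B)" "\<And>b. b \<in> B \<Longrightarrow> if e b \<le> j then u b \<in> G (j - e b) else u b = \<zero>"
    using u by (auto simp: free_degree_def)
  show "a \<odot>\<^bsub>free_module R B\<^esub> u \<in> carrier (free_module R B)" by (rule free_module_closed(3)[OF ac u(1)])
  fix b assume b: "b \<in> B"
  show "if e b \<le> m + j then (a \<odot>\<^bsub>free_module R B\<^esub> u) b \<in> K (m + j - e b)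
    else (a \<odot>\<^bsub>free_module R B\<^esub> u) b = \<zero>"
  proof (cases "e b \<le> j")
    case True
    then have ub: "u b \<in> G (j - e b)" using u(2)[OF b] by simp
    have "u b \<otimes> a \<in> K (j - e b + m)" by (rule graded_ideal_mult[OF K ub a])
    moreover have "u b \<otimes> a = a \<otimes> u b" using ac ub degree_closed m_comm by blast
    ultimately show ?thesis using True b by (simp add: free_module_coord add.commute)
  next
    case False
    then show ?thesis using u(2)[OF b] b ac graded_ideal_zero[OF K] by (simp add: free_module_coord)
  qed
qed

lemma ideal_times_free_minus:
  assumes "graded_ideal K" "u \<in> ideal_times_free K B e j" "v \<in> ideal_times_free K B e j"
  shows "u \<ominus>\<^bsub>free_module R B\<^esub> v \<in> ideal_times_free K B e j"
proof -
  have "\<ominus> \<one> \<odot>\<^bsub>free_module R B\<^esub> v \<in> ideal_times_free K B e (0 + j)"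
    using assms by (intro ideal_times_free_smult degree_minus one_in_degree)
  then show ?thesis unfolding a_minus_def
    using assms ideal_times_free_add free_module_uminus[OF free_degree_closed[OF ideal_times_free_free[OF assms(3)]]] by simp
qed

lemma free_degree_add: "u \<in> free_degree R G B e j \<Longrightarrow> v \<in> free_degree R G B e j \<Longrightarrow>
    u \<oplus>\<^bsub>free_module R B\<^esub> v \<in> free_degree R G B e j"
  and free_degree_minus: "u \<in> free_degree R G B e j \<Longrightarrow> v \<in> free_degree R G B e j \<Longrightarrow>
    u \<ominus>\<^bsub>free_module R B\<^esub> v \<in> free_degree R G B e j"
  and free_degree_smult: "a \<in> G m \<Longrightarrow> u \<in> free_degree R G B e j \<Longrightarrow>
    a \<odot>\<^bsub>free_module R B\<^esub> u \<in> free_degree R G B e (m + j)"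
  unfolding free_degree_eq_ideal_times_free
  by (rule ideal_times_free_add ideal_times_free_minus ideal_times_free_smult, rule graded_ideal_unit, assumption+)+

text \<open>A homogeneous vector is the sum over the basis of its coordinates times basis vectors, and a
coordinate in \<open>K\<close> multiplies the image of its basis vector into \<open>K\<close> times the target.\<close>

lemma hom_preserves_ideal_times_free:
  assumes f: "f \<in> module_homs R (free_module R B) (free_module R B')"
    and deg: "\<And>j. f ` free_degree R G B e j \<subseteq> free_degree R G B' e' j"
    and K: "graded_ideal K" and u: "u \<in> ideal_times_free K B e j"
  shows "f u \<in> ideal_times_free K B' e' j"
proof -
  have "f u \<in> ideal_times_free K B' e' j"
    if "finite T" "T \<subseteq> B" "u \<in> ideal_times_free K B e j" "{b \<in> B. u b \<noteq> \<zero>} \<subseteq> T" for T u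
    using that
  proof (induction T arbitrary: u rule: finite_induct)
    case empty
    have "u = \<zero>\<^bsub>free_module R B\<^esub>"
      using empty by (intro free_module_eqI[of _ R B] free_module_closed)
        (auto simp: ideal_times_free_coord[OF K] free_module_coord)
    then show ?case using module_hom_zero[OF f] ideal_times_free_zero[OF K] by simp
  next
    case (insert b T)
    let ?F = "free_module R B"
    define \<delta> where "\<delta> = (\<lambda>x\<in>B. if x = b then \<one> else \<zero>)"
    define u' where "u' = (\<lambda>x\<in>B. if x = b then \<zero> else u x)"
    have b: "b \<in> B" using insert by simp
    have uc: "u \<in> carrier ?F" and ud: "\<And>b. b \<in> B \<Longrightarrow> if e b \<le> j then u b \<in> K (j - e b) else u b = \<zero>"
      using insert.prems by (auto simp: ideal_times_free_coord[OF K])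
    have ubc: "u x \<in> carrier R" if "x \<in> B" for x using uc that by (rule free_module_coord_closed)
    have \<delta>c: "\<delta> \<in> carrier ?F"
    proof -
      have "{x \<in> B. \<delta> x \<noteq> \<zero>} \<subseteq> {b}" by (auto simp: \<delta>_def)
      then show ?thesis by (auto simp: free_module_carrier \<delta>_def intro: finite_subset)
    qed
    have \<delta>: "\<delta> \<in> free_degree R G B e (e b)"
      using \<delta>c one_in_degree zero_in_degree by (auto simp: free_degree_def \<delta>_def)
    have u'c: "u' \<in> carrier ?F"
    proof -
      have "{x \<in> B. u' x \<noteq> \<zero>} \<subseteq> {x \<in> B. u x \<noteq> \<zero>}" by (auto simp: u'_def)
      then have "finite {x \<in> B. u' x \<noteq> \<zero>}"
        using uc by (auto simp: free_module_carrier intro: finite_subset)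
      then show ?thesis using uc by (auto simp: free_module_carrier u'_def)
    qed
    have u': "u' \<in> ideal_times_free K B e j"
      using u'c ud graded_ideal_zero[OF K] by (auto simp: ideal_times_free_coord[OF K] u'_def)
    have IH: "f u' \<in> ideal_times_free K B' e' j"
      using insert by (intro insert.IH u') (auto simp: u'_def)
    have bu: "u b \<odot>\<^bsub>?F\<^esub> \<delta> \<in> carrier ?F" using ubc[OF b] \<delta>c by (rule free_module_closed(3))
    have "u = u b \<odot>\<^bsub>?F\<^esub> \<delta> \<oplus>\<^bsub>?F\<^esub> u'"
      using b ubc by (intro free_module_eqI[of _ R B] uc free_module_closed(2)[OF bu u'c])
        (auto simp: free_module_coord \<delta>_def u'_def)
    then have "f u = f (u b \<odot>\<^bsub>?F\<^esub> \<delta> \<oplus>\<^bsub>?F\<^esub> u')" by simp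
    also have "\<dots> = f (u b \<odot>\<^bsub>?F\<^esub> \<delta>) \<oplus>\<^bsub>free_module R B'\<^esub> f u'"
      using f bu u'c unfolding module_homs_def by blast
    also have "f (u b \<odot>\<^bsub>?F\<^esub> \<delta>) = u b \<odot>\<^bsub>free_module R B'\<^esub> f \<delta>"
      using f \<delta>c ubc[OF b] unfolding module_homs_def by blast
    finally have fu: "f u = u b \<odot>\<^bsub>free_module R B'\<^esub> f \<delta> \<oplus>\<^bsub>free_module R B'\<^esub> f u'" .
    have f\<delta>: "f \<delta> \<in> free_degree R G B' e' (e b)" using deg \<delta> by blast
    have "u b \<odot>\<^bsub>free_module R B'\<^esub> f \<delta> \<in> ideal_times_free K B' e' j"
    proof (cases "e b \<le> j")
      case True
      then have "u b \<in> K (j - e b)" using ud[OF b] by simp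
      from ideal_times_free_smult_right[OF K this f\<delta>] show ?thesis using True by simp
    next
      case False
      interpret N: module R "free_module R B'" by (rule free_module_is_module)
      from False have "u b = \<zero>" using ud[OF b] by simp
      then show ?thesis using free_degree_closed[OF f\<delta>] ideal_times_free_zero[OF K] by simp
    qed
    then show ?case unfolding fu using IH by (intro ideal_times_free_add[OF K])
  qed
  from this[of "{b \<in> B. u b \<noteq> \<zero>}" u] show ?thesis
    using u by (auto simp: ideal_times_free_coord[OF K] free_module_carrier)
qed

end

section \<open>Ideals filtered by linear forms and vanishing of Tor\<close>

context graded_free_resolution
begin

abbreviation "F i \<equiv> free_module R (B i)"
abbreviation "F_degree i j \<equiv> free_degree R G (B i) (e i) j"
abbreviation "ideal_F K i j \<equiv> ideal_times_free K (B i) (e i) j"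

lemma F_module: "module R (F i)"
  by (rule free_module_is_module)

lemma d_closed: "u \<in> carrier (F (Suc i)) \<Longrightarrow> d i u \<in> carrier (F i)"
  using d_hom[of i] by (auto simp: module_homs_def)

lemma d_add: "u \<in> carrier (F (Suc i)) \<Longrightarrow> v \<in> carrier (F (Suc i)) \<Longrightarrow>
    d i (u \<oplus>\<^bsub>F (Suc i)\<^esub> v) = d i u \<oplus>\<^bsub>F i\<^esub> d i v"
  using d_hom[of i] by (auto simp: module_homs_def)

lemma d_smult: "a \<in> carrier R \<Longrightarrow> u \<in> carrier (F (Suc i)) \<Longrightarrow>
    d i (a \<odot>\<^bsub>F (Suc i)\<^esub> u) = a \<odot>\<^bsub>F i\<^esub> d i u"
  using d_hom[of i] by (auto simp: module_homs_def)

lemma d_ideal_times_free: "graded_ideal K \<Longrightarrow> u \<in> ideal_F K (Suc i) j \<Longrightarrow> d i u \<in> ideal_F K i j"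
  by (rule hom_preserves_ideal_times_free[OF d_hom d_degree])

lemma d_free: "u \<in> F_degree (Suc i) j \<Longrightarrow> d i u \<in> F_degree i j"
  using d_degree by blast

lemma d_d: "u \<in> F_degree (Suc (Suc i)) j \<Longrightarrow> d i (d (Suc i) u) = \<zero>\<^bsub>F i\<^esub>"
  using exact_Suc[of i j] by blast

text \<open>Representatives in \<open>F i\<close> of the degree \<open>j\<close> cycles of the complex \<open>F / K F\<close>, truncated before the
augmentation: every vector of \<open>F 0\<close> is a cycle.\<close>

definition cycles_mod :: "(nat \<Rightarrow> 'a set) \<Rightarrow> nat \<Rightarrow> nat \<Rightarrow> ('b \<Rightarrow> 'a) set" where
  "cycles_mod K i j = {u \<in> F_degree i j. case i of 0 \<Rightarrow> True | Suc l \<Rightarrow> d l u \<in> ideal_F K l j}"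

lemma ideal_times_free_zero_ideal: "ideal_F (\<lambda>m. {\<zero>}) i j = {\<zero>\<^bsub>F i\<^esub>}"
proof -
  have "u = \<zero>\<^bsub>F i\<^esub>" if "u \<in> ideal_F (\<lambda>m. {\<zero>}) i j" for u
    using that by (intro free_module_eqI[of _ R "B i"] free_module_closed)
      (auto simp: ideal_times_free_coord[OF graded_ideal_zero_ideal] free_module_coord split: if_splits)
  then show ?thesis using ideal_times_free_zero[OF graded_ideal_zero_ideal] by blast
qed

text \<open>For \<open>i = 0\<close> the hypothesis excludes degree \<open>0\<close>, the only degree in which the ground field, and
hence the homology of \<open>F\<close> at \<open>0\<close>, is nonzero.\<close>

lemma cycle_is_boundary:
  assumes "u \<in> cycles_mod (\<lambda>m. {\<zero>}) i j" "i \<noteq> j"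
  shows "\<exists>v\<in>F_degree (Suc i) j. u = d i v"
proof (cases i)
  case 0
  then have "u \<in> F_degree 0 j" "0 < j" using assms by (auto simp: cycles_mod_def)
  then have "\<epsilon> u = \<zero>\<^bsub>residue_module R G\<^esub>" using \<epsilon>_degree by blast
  then show ?thesis using \<open>u \<in> F_degree 0 j\<close> exact_0[of j] 0 by auto
next
  case (Suc l)
  then have "u \<in> {u \<in> F_degree (Suc l) j. d l u = \<zero>\<^bsub>F l\<^esub>}"
    using assms by (auto simp: cycles_mod_def ideal_times_free_zero_ideal)
  then show ?thesis unfolding exact_Suc Suc by blast
qed

text \<open>The coordinates of \<open>x\<close> are split separately.  A coordinate at a basis element of degree \<open>Suc j\<close>
lies in the degree \<open>0\<close> part of the ideal, so it vanishes and needs no multiple of \<open>w\<close>.\<close>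

lemma ideal_times_free_adjoin_split:
  assumes K: "graded_ideal K" and K0: "K 0 = {\<zero>}" and w: "w \<in> G 1"
    and x: "x \<in> ideal_F (adjoin K w) i (Suc j)"
  shows "\<exists>y\<in>ideal_F K i (Suc j). \<exists>z\<in>F_degree i j. x = y \<oplus>\<^bsub>F i\<^esub> w \<odot>\<^bsub>F i\<^esub> z"
proof -
  have wc: "w \<in> carrier R" using w degree_closed by blast
  have xc: "x \<in> carrier (F i)"
    and xb: "\<And>b. b \<in> B i \<Longrightarrow> if e i b \<le> Suc j then x b \<in> adjoin K w (Suc j - e i b) else x b = \<zero>"
    using x unfolding ideal_times_free_coord[OF graded_ideal_adjoin[OF K w]] by auto
  define Q where "Q b p \<longleftrightarrow> (if e i b \<le> Suc j then fst p \<in> K (Suc j - e i b) else fst p = \<zero>) \<and>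
      (if e i b \<le> j then snd p \<in> G (j - e i b) else snd p = \<zero>) \<and>
      x b = fst p \<oplus> w \<otimes> snd p \<and> (x b = \<zero> \<longrightarrow> p = (\<zero>, \<zero>))" for b p
  have "\<exists>p. Q b p" if b: "b \<in> B i" for b
  proof (cases "x b = \<zero>")
    case True
    then show ?thesis unfolding Q_def using graded_ideal_zero[OF K] zero_in_degree wc by (intro exI[of _ "(\<zero>, \<zero>)"]) auto
  next
    case False
    then have le: "e i b \<le> Suc j" and mem: "x b \<in> adjoin K w (Suc j - e i b)"
      using xb[OF b] by (auto split: if_splits)
    have "e i b \<noteq> Suc j"
    proof
      assume "e i b = Suc j"
      then have "x b \<in> adjoin K w 0" using mem by simp
      then show False using False by (simp add: adjoin_def K0)
    qed
    then have le': "e i b \<le> j" using le by linarith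
    then have eq: "Suc j - e i b = Suc (j - e i b)" by (rule Suc_diff_le)
    obtain y z where "x b = y \<oplus> w \<otimes> z" "y \<in> K (Suc j - e i b)" "z \<in> G (j - e i b)"
      using mem by (auto simp: eq adjoin_def)
    then show ?thesis unfolding Q_def using le le' False by (intro exI[of _ "(y, z)"]) auto
  qed
  then obtain p where "\<forall>b\<in>B i. Q b (p b)" using bchoice[of "B i" Q] by blast
  then have p_y: "if e i b \<le> Suc j then fst (p b) \<in> K (Suc j - e i b) else fst (p b) = \<zero>"
    and p_z: "if e i b \<le> j then snd (p b) \<in> G (j - e i b) else snd (p b) = \<zero>"
    and p_eq: "x b = fst (p b) \<oplus> w \<otimes> snd (p b)" and p_null: "x b = \<zero> \<Longrightarrow> p b = (\<zero>, \<zero>)"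
    if "b \<in> B i" for b
    using that unfolding Q_def by blast+
  define y where "y = (\<lambda>b\<in>B i. fst (p b))"
  define z where "z = (\<lambda>b\<in>B i. snd (p b))"
  have fin: "finite {b \<in> B i. x b \<noteq> \<zero>}" using xc by (simp add: free_module_carrier)
  have "y \<in> carrier (F i)"
  proof -
    have "{b \<in> B i. y b \<noteq> \<zero>} \<subseteq> {b \<in> B i. x b \<noteq> \<zero>}" using p_null by (auto simp: y_def)
    moreover have "y b \<in> carrier R" if "b \<in> B i" for b
      using p_y[OF that] graded_ideal_closed[OF K] that by (auto simp: y_def split: if_splits)
    ultimately show ?thesis using finite_subset[OF _ fin] by (auto simp: free_module_carrier y_def)
  qed
  then have y: "y \<in> ideal_F K i (Suc j)" using p_y unfolding ideal_times_free_coord[OF K] by (auto simp: y_def)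
  have "z \<in> carrier (F i)"
  proof -
    have "{b \<in> B i. z b \<noteq> \<zero>} \<subseteq> {b \<in> B i. x b \<noteq> \<zero>}" using p_null by (auto simp: z_def)
    moreover have "z b \<in> carrier R" if "b \<in> B i" for b
      using p_z[OF that] degree_closed that by (auto simp: z_def split: if_splits)
    ultimately show ?thesis using finite_subset[OF _ fin] by (auto simp: free_module_carrier z_def)
  qed
  then have z: "z \<in> F_degree i j" using p_z unfolding free_degree_def by (auto simp: z_def)
  have "x = y \<oplus>\<^bsub>F i\<^esub> w \<odot>\<^bsub>F i\<^esub> z"
    using p_eq by (intro free_module_eqI[of _ R "B i"] xc free_module_closed wc
      free_degree_closed[OF z] free_degree_closed[OF ideal_times_free_free[OF y]])
      (simp add: free_module_coord y_def z_def)
  then show ?thesis using y z by blast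
qed

text \<open>In other words, the homology of the complex \<open>K F\<close> at \<open>i\<close> is concentrated in degree \<open>Suc i\<close>.
If a cycle is \<open>x = y + w z\<close>, with \<open>y\<close> over the smaller ideal \<open>K\<close>, then
\<open>w d z = - d y\<close> shows that \<open>z\<close> is a cycle modulo \<open>K : w\<close>, of degree one less than \<open>x\<close>.  By the
assumption on the members of \<open>\<F>\<close>, \<open>z = d v + q\<close> with \<open>q\<close> over \<open>K : w\<close>, and \<open>x - d (w v) = y + w q\<close> is a
cycle over \<open>K\<close>.\<close>

lemma lift_along_filtration:
  assumes IH: "\<And>K j u. K \<in> \<F> \<Longrightarrow> i \<noteq> j \<Longrightarrow> u \<in> cycles_mod K i j \<Longrightarrow>
      \<exists>v\<in>F_degree (Suc i) j. \<exists>w\<in>ideal_F K i j. u = d i v \<oplus>\<^bsub>F i\<^esub> w"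
    and K: "linear_filtration \<F> K" and "j \<noteq> Suc i"
    and "x \<in> ideal_F K i j" "x \<in> cycles_mod (\<lambda>m. {\<zero>}) i j"
  shows "\<exists>y\<in>ideal_F K (Suc i) j. x = d i y"
  using K \<open>x \<in> ideal_F K i j\<close> \<open>x \<in> cycles_mod (\<lambda>m. {\<zero>}) i j\<close>
proof (induction arbitrary: x rule: linear_filtration.induct)
  case zero
  then have "x = \<zero>\<^bsub>F i\<^esub>" by (simp add: ideal_times_free_zero_ideal)
  then show ?case using module_hom_zero[OF d_hom] by (simp add: ideal_times_free_zero_ideal)
next
  case (adjoin K w)
  interpret F: module R "F i" by (rule F_module)
  note K = linear_filtration_ideal[OF adjoin.hyps(1)]
  have w: "w \<in> carrier R" using adjoin.hyps(2) degree_closed by blast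
  have K': "graded_ideal (adjoin K w)" using K(1) adjoin.hyps(2) by (rule graded_ideal_adjoin)
  show ?case
  proof (cases j)
    case 0
    have "adjoin K w 0 = {\<zero>}" using K(2) by (simp add: adjoin_def)
    then have "x = \<zero>\<^bsub>F i\<^esub>"
      using adjoin.prems(1) 0 by (intro free_module_eqI[of _ R "B i"] free_module_closed)
        (auto simp: ideal_times_free_coord[OF K'] free_module_coord split: if_splits)
    then show ?thesis using module_hom_zero[OF d_hom] ideal_times_free_zero[OF K'] by metis
  next
    case (Suc l)
    obtain y z where y: "y \<in> ideal_F K i j" and z: "z \<in> F_degree i l" and x: "x = y \<oplus>\<^bsub>F i\<^esub> w \<odot>\<^bsub>F i\<^esub> z"
      using ideal_times_free_adjoin_split[OF K adjoin.hyps(2)] adjoin.prems(1) unfolding Suc by blast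
    have yz: "y \<in> carrier (F i)" "z \<in> carrier (F i)"
      using y z free_degree_closed ideal_times_free_free by blast+
    have "z \<in> cycles_mod (colon K w) i l"
    proof (cases i)
      case 0
      then show ?thesis using z by (simp add: cycles_mod_def)
    next
      case (Suc h)
      interpret E: module R "F h" by (rule F_module)
      have dyz: "d h y \<in> carrier (F h)" "d h z \<in> carrier (F h)" using yz d_closed Suc by auto
      have "d h x = \<zero>\<^bsub>F h\<^esub>" using adjoin.prems(2) Suc by (simp add: cycles_mod_def ideal_times_free_zero_ideal)
      moreover have "d h x = d h y \<oplus>\<^bsub>F h\<^esub> w \<odot>\<^bsub>F h\<^esub> d h z"
        using yz w unfolding x Suc by (simp add: d_add d_smult free_module_closed)
      ultimately have "w \<odot>\<^bsub>F h\<^esub> d h z = \<zero>\<^bsub>F h\<^esub> \<ominus>\<^bsub>F h\<^esub> d h y"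
        using dyz w by (metis E.add.inv_equality E.add.m_comm E.minus_eq E.l_zero E.smult_closed E.a_inv_closed)
      moreover have "d h y \<in> ideal_F K h j" using d_ideal_times_free[OF K(1)] y Suc by blast
      ultimately have wz: "w \<odot>\<^bsub>F h\<^esub> d h z \<in> ideal_F K h (Suc l)"
        using ideal_times_free_minus[OF K(1) ideal_times_free_zero[OF K(1)]] \<open>j = Suc l\<close> by simp
      have dz: "d h z \<in> F_degree h l" using z d_free Suc by blast
      have "d h z \<in> ideal_F (colon K w) h l"
        unfolding ideal_times_free_def
      proof (intro CollectI conjI ballI impI dz)
        fix b assume b: "b \<in> B h" "e h b \<le> l"
        have "d h z b \<in> G (l - e h b)" using dz b by (auto simp: free_degree_def)
        moreover have "w \<otimes> d h z b \<in> K (Suc l - e h b)"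
          using wz b free_module_coord(3)[OF b(1), of R w "d h z"] unfolding ideal_times_free_def by fastforce
        ultimately show "d h z b \<in> colon K w (l - e h b)"
          using b by (simp add: colon_def Suc_diff_le)
      qed
      then show ?thesis using z Suc by (simp add: cycles_mod_def)
    qed
    moreover have "i \<noteq> l" using \<open>j \<noteq> Suc i\<close> Suc by simp
    ultimately obtain v q where v: "v \<in> F_degree (Suc i) l" and q: "q \<in> ideal_F (colon K w) i l"
      and zq: "z = d i v \<oplus>\<^bsub>F i\<^esub> q"
      using IH[OF adjoin.hyps(3)] by blast
    have vq: "v \<in> carrier (F (Suc i))" "q \<in> carrier (F i)" "d i v \<in> carrier (F i)"
      using v q free_degree_closed ideal_times_free_free d_closed by blast+
    have wq: "w \<odot>\<^bsub>F i\<^esub> q \<in> ideal_F K i j"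
    proof -
      have "w \<odot>\<^bsub>F i\<^esub> q \<in> F_degree i j"
        using free_degree_smult[OF adjoin.hyps(2) ideal_times_free_free[OF q]] Suc by simp
      moreover have "(w \<odot>\<^bsub>F i\<^esub> q) b \<in> K (j - e i b)" if b: "b \<in> B i" "e i b \<le> j" for b
      proof (cases "e i b \<le> l")
        case True
        then have "q b \<in> colon K w (l - e i b)" using q b by (simp add: ideal_times_free_def)
        then show ?thesis using True Suc b by (simp add: colon_def free_module_coord Suc_diff_le)
      next
        case False
        then have "q b = \<zero>" using ideal_times_free_free[OF q] b by (auto simp: free_degree_def)
        then show ?thesis using b w graded_ideal_zero[OF K(1)] by (simp add: free_module_coord)
      qed
      ultimately show ?thesis by (simp add: ideal_times_free_def)
    qed
    define x' where "x' = y \<oplus>\<^bsub>F i\<^esub> w \<odot>\<^bsub>F i\<^esub> q"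
    have x': "x' \<in> ideal_F K i j" unfolding x'_def using y wq by (rule ideal_times_free_add[OF K(1)])
    have x'c: "x' \<in> carrier (F i)" using x' free_degree_closed ideal_times_free_free by blast
    have wv: "w \<odot>\<^bsub>F (Suc i)\<^esub> v \<in> F_degree (Suc i) j"
      using free_degree_smult[OF adjoin.hyps(2) v] Suc by simp
    have wvc: "w \<odot>\<^bsub>F (Suc i)\<^esub> v \<in> carrier (F (Suc i))" using wv free_degree_closed by blast
    have xx': "x = x' \<oplus>\<^bsub>F i\<^esub> d i (w \<odot>\<^bsub>F (Suc i)\<^esub> v)"
      using yz vq w unfolding x x'_def zq by (simp add: d_smult F.smult_r_distr F.a_ac)
    have "x' \<in> cycles_mod (\<lambda>m. {\<zero>}) i j"
    proof (cases i)
      case 0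
      then show ?thesis using ideal_times_free_free[OF x'] by (simp add: cycles_mod_def)
    next
      case (Suc h)
      interpret E: module R "F h" by (rule F_module)
      have "d h x = \<zero>\<^bsub>F h\<^esub>" using adjoin.prems(2) Suc by (simp add: cycles_mod_def ideal_times_free_zero_ideal)
      moreover have "d h x = d h x' \<oplus>\<^bsub>F h\<^esub> d h (d i (w \<odot>\<^bsub>F (Suc i)\<^esub> v))"
        using x'c d_closed[OF wvc] unfolding xx' Suc by (simp add: d_add)
      moreover have "d h (d i (w \<odot>\<^bsub>F (Suc i)\<^esub> v)) = \<zero>\<^bsub>F h\<^esub>" using wv d_d Suc by blast
      moreover have "d h x' \<in> carrier (F h)" using x'c d_closed Suc by blast
      ultimately have "d h x' = \<zero>\<^bsub>F h\<^esub>" by simp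
      then show ?thesis using ideal_times_free_free[OF x'] Suc by (simp add: cycles_mod_def ideal_times_free_zero_ideal)
    qed
    then obtain y' where y': "y' \<in> ideal_F K (Suc i) j" "x' = d i y'"
      using adjoin.IH[OF x'] by blast
    have y'c: "y' \<in> carrier (F (Suc i))" using y' free_degree_closed ideal_times_free_free by blast
    have "x = d i (y' \<oplus>\<^bsub>F (Suc i)\<^esub> w \<odot>\<^bsub>F (Suc i)\<^esub> v)"
      unfolding xx' y'(2) by (rule d_add[symmetric, OF y'c wvc])
    moreover have "y' \<oplus>\<^bsub>F (Suc i)\<^esub> w \<odot>\<^bsub>F (Suc i)\<^esub> v \<in> ideal_F (adjoin K w) (Suc i) j"
    proof -
      have sub: "p \<in> adjoin K w m" if "p \<in> K m" for p m
      proof (cases m)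
        case 0
        then show ?thesis using that by (simp add: adjoin_def)
      next
        case (Suc k)
        have "p = p \<oplus> w \<otimes> \<zero>" using graded_ideal_closed[OF K(1) that] w by simp
        then show ?thesis using Suc that zero_in_degree[of k] unfolding adjoin_def by auto
      qed
      have "w = \<zero> \<oplus> w \<otimes> \<one>" using w by simp
      then have "w \<in> adjoin K w 1"
        using graded_ideal_zero[OF K(1)] one_in_degree by (auto simp: adjoin_def)
      then have "w \<odot>\<^bsub>F (Suc i)\<^esub> v \<in> ideal_F (adjoin K w) (Suc i) j"
        using ideal_times_free_smult_right[OF K' _ v, of w 1] Suc by simp
      moreover have "y' \<in> ideal_F (adjoin K w) (Suc i) j"
        using y'(1) sub by (auto simp: ideal_times_free_def)
      ultimately show ?thesis by (intro ideal_times_free_add[OF K'])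
    qed
    ultimately show ?thesis by blast
  qed
qed

text \<open>This is the vanishing of \<open>Tor i j\<close> for \<open>R\<close> modulo \<open>K\<close> and the ground field.  A cycle \<open>u\<close> modulo \<open>K\<close> has its
boundary \<open>d u\<close> in \<open>K F\<close>; lifting this boundary to \<open>y\<close> in \<open>K F\<close> makes \<open>u - y\<close> a cycle of the exact
complex \<open>F\<close>.\<close>

lemma homology_mod_ideal:
  assumes \<F>: "\<And>K. K \<in> \<F> \<Longrightarrow> linear_filtration \<F> K"
    and "K \<in> \<F>" "i \<noteq> j" "u \<in> cycles_mod K i j"
  shows "\<exists>v\<in>F_degree (Suc i) j. \<exists>w\<in>ideal_F K i j. u = d i v \<oplus>\<^bsub>F i\<^esub> w"
  using assms(2-4)
proof (induction i arbitrary: K j u)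
  case 0
  then have "u \<in> cycles_mod (\<lambda>m. {\<zero>}) 0 j" by (simp add: cycles_mod_def)
  then obtain v where v: "v \<in> F_degree (Suc 0) j" "u = d 0 v" using cycle_is_boundary 0 by blast
  interpret F: module R "F 0" by (rule F_module)
  have "u \<in> carrier (F 0)" using 0 free_degree_closed unfolding cycles_mod_def by blast
  then have "u = d 0 v \<oplus>\<^bsub>F 0\<^esub> \<zero>\<^bsub>F 0\<^esub>" using v(2) by simp
  then show ?case using v ideal_times_free_zero[OF linear_filtration_ideal(1)[OF \<F>[OF 0(1)]]] by blast
next
  case (Suc i)
  interpret F: module R "F (Suc i)" by (rule F_module)
  interpret E: module R "F i" by (rule F_module)
  have u: "u \<in> F_degree (Suc i) j" and du: "d i u \<in> ideal_F K i j" using Suc.prems by (auto simp: cycles_mod_def)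
  have "d i u \<in> cycles_mod (\<lambda>m. {\<zero>}) i j"
    using d_free[OF u] d_d u by (auto simp: cycles_mod_def ideal_times_free_zero_ideal split: nat.split)
  then obtain y where y: "y \<in> ideal_F K (Suc i) j" and dy: "d i u = d i y"
    using lift_along_filtration[OF Suc.IH \<F>[OF Suc.prems(1)] _ du] Suc.prems(2) by metis
  have uy: "u \<in> carrier (F (Suc i))" "y \<in> carrier (F (Suc i))"
    using u y free_degree_closed ideal_times_free_free by blast+
  have "d i (u \<ominus>\<^bsub>F (Suc i)\<^esub> y) = d i u \<ominus>\<^bsub>F i\<^esub> d i y"
    by (rule module_hom_minus[OF d_hom uy])
  also have "\<dots> = \<zero>\<^bsub>F i\<^esub>" using d_closed[OF uy(2)] unfolding dy by (simp add: E.r_neg E.minus_eq)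
  finally have "u \<ominus>\<^bsub>F (Suc i)\<^esub> y \<in> cycles_mod (\<lambda>m. {\<zero>}) (Suc i) j"
    using free_degree_minus[OF u ideal_times_free_free[OF y]] by (simp add: cycles_mod_def ideal_times_free_zero_ideal)
  then obtain v where v: "v \<in> F_degree (Suc (Suc i)) j" "u \<ominus>\<^bsub>F (Suc i)\<^esub> y = d (Suc i) v"
    using cycle_is_boundary Suc.prems(2) by blast
  have "u = (u \<ominus>\<^bsub>F (Suc i)\<^esub> y) \<oplus>\<^bsub>F (Suc i)\<^esub> y"
    using uy by (simp add: F.minus_eq F.a_assoc F.l_neg)
  then show ?case using v y by metis
qed

end

context graded_algebra
begin

text \<open>The homogeneous parts of the irrelevant ideal, as \<open>irrelevant_ideal_degree\<close> confirms.\<close>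

definition irrelevant_degree :: "nat \<Rightarrow> 'a set" where
  "irrelevant_degree m = (if m = 0 then {\<zero>} else G m)"

text \<open>An explicit form of the irrelevant ideal: the sums of homogeneous elements of positive degree.  It
serves to show that the irrelevant ideal contains no nonzero element of degree \<open>0\<close>.\<close>

inductive_set positive_part :: "'a set" where
  zero: "\<zero> \<in> positive_part"
| add: "0 < m \<Longrightarrow> x \<in> G m \<Longrightarrow> y \<in> positive_part \<Longrightarrow> x \<oplus> y \<in> positive_part"

lemma positive_part_closed: "x \<in> positive_part \<Longrightarrow> x \<in> carrier R"
  by (induction rule: positive_part.induct) (auto intro: degree_closed)

lemma positive_part_add:
  assumes "x \<in> positive_part" "y \<in> positive_part"
  shows "x \<oplus> y \<in> positive_part"
  using assms
proof induction
  case zero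
  then show ?case using positive_part_closed by simp
next
  case (add m x z)
  then have "(x \<oplus> z) \<oplus> y = x \<oplus> (z \<oplus> y)"
    using positive_part_closed degree_closed by (simp add: a_assoc)
  then show ?case using add positive_part.add by simp
qed

lemma positive_part_mult_degree:
  assumes "x \<in> positive_part" "a \<in> G l"
  shows "a \<otimes> x \<in> positive_part"
  using assms(1)
proof induction
  case zero
  then show ?case using assms(2) degree_closed positive_part.zero by simp
next
  case (add m x z)
  then have "a \<otimes> (x \<oplus> z) = a \<otimes> x \<oplus> a \<otimes> z"
    using positive_part_closed degree_closed assms(2) by (simp add: r_distr)
  then show ?case using add positive_part.add[of "l + m" "a \<otimes> x"] degree_mult assms(2) by simp
qed

lemma positive_part_mult:
  assumes x: "x \<in> positive_part" and a: "a \<in> carrier R"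
  shows "a \<otimes> x \<in> positive_part"
proof -
  obtain c where c: "\<And>m. c m \<in> G m" and fin: "finite {m. c m \<noteq> \<zero>}"
    and sum: "a = finsum R c {m. c m \<noteq> \<zero>}"
    using decomposition[OF a] by auto
  have "finsum R c T \<otimes> x \<in> positive_part" if "finite T" for T
    using that
  proof (induction T rule: finite_induct)
    case empty
    then show ?case using positive_part_closed[OF x] positive_part.zero by simp
  next
    case (insert m T)
    have cl: "c m \<in> carrier R" for m using c degree_closed by blast
    have "finsum R c (insert m T) \<otimes> x = c m \<otimes> x \<oplus> finsum R c T \<otimes> x"
      using insert positive_part_closed[OF x] cl by (simp add: l_distr Pi_def)
    then show ?case using insert positive_part_add positive_part_mult_degree[OF x c] by simp
  qed
  then show ?thesis using sum fin by simp
qed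

text \<open>Otherwise \<open>a\<close> would have two decompositions into homogeneous parts.\<close>

lemma positive_part_degree_zero:
  assumes "a \<in> positive_part" "a \<in> G 0"
  shows "a = \<zero>"
proof -
  have "\<exists>T c. finite T \<and> 0 \<notin> T \<and> (\<forall>m. c m \<in> G m) \<and> a = finsum R c T"
    using assms(1)
  proof induction
    case zero
    show ?case by (rule exI[of _ "{}"], rule exI[of _ "\<lambda>_. \<zero>"]) (simp add: zero_in_degree)
  next
    case (add m x y)
    then obtain T c where T: "finite T" "0 \<notin> T" and c: "\<And>m. c m \<in> G m" and y: "y = finsum R c T"
      by blast
    have cl: "c m \<in> carrier R" for m using c degree_closed by blast
    have x: "x \<in> carrier R" using add degree_closed by blast
    define c' where "c' = (\<lambda>l. if l = m then (if m \<in> T then x \<oplus> c m else x) else c l)"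
    have c': "c' l \<in> G l" for l using c add(2) degree_add by (auto simp: c'_def)
    have cl': "c' l \<in> carrier R" for l using c' degree_closed by blast
    have rest: "finsum R c' (T - {m}) = finsum R c (T - {m})"
      by (rule add.finprod_cong') (auto simp: c'_def cl)
    have "finsum R c' (insert m T) = finsum R c' (insert m (T - {m}))" by simp
    also have "\<dots> = c' m \<oplus> finsum R c (T - {m})"
      using T cl' rest by (subst finsum_insert) auto
    also have "\<dots> = x \<oplus> y"
    proof (cases "m \<in> T")
      case True
      then have "y = finsum R c (insert m (T - {m}))" by (simp add: y insert_absorb)
      also have "\<dots> = c m \<oplus> finsum R c (T - {m})" using T cl by (subst finsum_insert) auto
      finally show ?thesis using True x cl by (simp add: c'_def a_assoc finsum_closed Pi_def)
    next
      case False
      then show ?thesis by (simp add: c'_def y)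
    qed
    finally show ?case using T c' add(1) by (intro exI[of _ "insert m T"] exI[of _ c']) simp
  qed
  then obtain T c where T: "finite T" "0 \<notin> T" and c: "\<And>m. c m \<in> G m" and a: "a = finsum R c T"
    by blast
  have cl: "c m \<in> carrier R" for m using c degree_closed by blast
  have ac: "a \<in> carrier R" using assms(2) by (rule degree_closed)
  define c1 where "c1 m = (if m \<in> T then c m else \<zero>)" for m
  define c2 where "c2 m = (if m = 0 then a else \<zero>)" for m :: nat
  have s1: "{m. c1 m \<noteq> \<zero>} \<subseteq> T" by (auto simp: c1_def)
  have "a = finsum R c1 {m. c1 m \<noteq> \<zero>}"
    unfolding a using T s1 cl by (intro add.finprod_mono_neutral_cong_right) (auto simp: c1_def)
  then have 1: "(\<forall>m. c1 m \<in> G m) \<and> finite {m. c1 m \<noteq> \<zero>} \<and> a = finsum R c1 {m. c1 m \<noteq> \<zero>}"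
    using c zero_in_degree finite_subset[OF s1 T(1)] by (simp add: c1_def)
  have s2: "{m. c2 m \<noteq> \<zero>} \<subseteq> {0}" by (auto simp: c2_def)
  have "finsum R c2 {0} = finsum R c2 {m. c2 m \<noteq> \<zero>}"
    using s2 ac by (intro add.finprod_mono_neutral_cong_right) (auto simp: c2_def)
  moreover have "finsum R c2 {0} = a" using ac by (simp add: c2_def)
  ultimately have 2: "(\<forall>m. c2 m \<in> G m) \<and> finite {m. c2 m \<noteq> \<zero>} \<and> a = finsum R c2 {m. c2 m \<noteq> \<zero>}"
    using assms(2) zero_in_degree finite_subset[OF s2] by (simp add: c2_def)
  have "c1 = c2" using decomposition[OF ac] 1 2 by blast
  then have "c1 0 = c2 0" by simp
  then show ?thesis using T by (simp add: c1_def c2_def)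
qed

lemma irrelevant_ideal_degree:
  assumes "x \<in> G m"
  shows "x \<in> irrelevant_ideal R G \<longleftrightarrow> x \<in> irrelevant_degree m"
proof -
  have sub: "(\<Union>m\<in>{0<..}. G m) \<subseteq> carrier R" using degree_closed by blast
  interpret I: ideal "irrelevant_ideal R G" R
    unfolding irrelevant_ideal_def using sub by (rule genideal_ideal)
  have "ideal positive_part R"
  proof (rule idealI)
    show "ring R" by (rule ring_axioms)
    show "subgroup positive_part (add_monoid R)"
    proof (rule add.subgroupI)
      show "positive_part \<subseteq> carrier R" using positive_part_closed by blast
      show "positive_part \<noteq> {}" using positive_part.zero by blast
      show "\<ominus> x \<in> positive_part" if "x \<in> positive_part" for x
        using positive_part_mult[OF that, of "\<ominus> \<one>"] positive_part_closed[OF that] by (simp add: l_minus)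
    qed (rule positive_part_add)
    show "a \<otimes> x \<in> positive_part" if "x \<in> positive_part" "a \<in> carrier R" for a x
      using that by (rule positive_part_mult)
    then show "x \<otimes> a \<in> positive_part" if "x \<in> positive_part" "a \<in> carrier R" for a x
      using that positive_part_closed m_comm by metis
  qed
  moreover have "(\<Union>m\<in>{0<..}. G m) \<subseteq> positive_part"
  proof (clarsimp)
    fix m x assume "0 < m" "x \<in> G m"
    then show "x \<in> positive_part" using positive_part.add[OF _ _ positive_part.zero] degree_closed by fastforce
  qed
  ultimately have I_sub: "irrelevant_ideal R G \<subseteq> positive_part"
    unfolding irrelevant_ideal_def by (rule genideal_minimal)
  show ?thesis
  proof (cases "m = 0")
    case True
    then show ?thesis using assms I_sub positive_part_degree_zero I.zero_closed by (auto simp: irrelevant_degree_def)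
  next
    case False
    then have "x \<in> irrelevant_ideal R G"
      using assms genideal_self[OF sub] unfolding irrelevant_ideal_def by auto
    then show ?thesis using False assms by (simp add: irrelevant_degree_def)
  qed
qed

lemma irrelevant_submodule_degree:
  assumes "u \<in> free_degree R G B e j"
  shows "u \<in> irrelevant_submodule R G B \<longleftrightarrow> u \<in> ideal_times_free irrelevant_degree B e j"
proof -
  have "u b \<in> irrelevant_ideal R G \<longleftrightarrow> (e b \<le> j \<longrightarrow> u b \<in> irrelevant_degree (j - e b))" if "b \<in> B" for b
  proof (cases "e b \<le> j")
    case True
    then have "u b \<in> G (j - e b)" using assms that by (auto simp: free_degree_def)
    then show ?thesis using irrelevant_ideal_degree True by simp
  next
    case False
    then have "u b = \<zero>" using assms that by (auto simp: free_degree_def)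
    then show ?thesis using False irrelevant_ideal_degree[OF zero_in_degree[of 0]] by (simp add: irrelevant_degree_def)
  qed
  then show ?thesis
    using assms by (auto simp: irrelevant_submodule_def ideal_times_free_def free_degree_def)
qed

text \<open>Modulo the irrelevant ideal, the cycles and boundaries of a graded free resolution of the ground
field are those that define Tor, so the claim is \<open>homology_mod_ideal\<close> for this ideal.\<close>

theorem koszul_if_linear_filtrations:
  assumes \<F>: "\<And>K. K \<in> \<F> \<Longrightarrow> linear_filtration \<F> K" and irr: "irrelevant_degree \<in> \<F>"
  shows "koszul R G"
  unfolding koszul_def tor_vanishes_def
proof (intro conjI allI impI)
  show "graded_algebra R G" by (rule graded_algebra_axioms)
  fix i j and B :: "nat \<Rightarrow> 'a list set" and e d \<epsilon>
  assume ij: "i \<noteq> (j :: nat)" and "graded_free_resolution R G B e d \<epsilon>"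
  then interpret F: graded_free_resolution R G B e d \<epsilon> by simp
  let ?m = irrelevant_degree
  have m: "graded_ideal ?m" by (rule linear_filtration_ideal(1)[OF \<F>[OF irr]])
  have cyc: "tor_cycles R G B e d i j = F.cycles_mod ?m i j"
    using irrelevant_submodule_degree[OF F.d_free]
    by (auto simp: tor_cycles_def F.cycles_mod_def split: nat.split)
  have bd: "tor_boundaries R G B e d i j = {d i v \<oplus>\<^bsub>F.F i\<^esub> w | v w. v \<in> F.F_degree (Suc i) j \<and> w \<in> F.ideal_F ?m i j}"
    unfolding tor_boundaries_def using irrelevant_submodule_degree ideal_times_free_free by blast
  show "tor_cycles R G B e d i j = tor_boundaries R G B e d i j"
    unfolding cyc bd
  proof (intro equalityI subsetI)
    fix u assume "u \<in> F.cycles_mod ?m i j"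
    then show "u \<in> {d i v \<oplus>\<^bsub>F.F i\<^esub> w | v w. v \<in> F.F_degree (Suc i) j \<and> w \<in> F.ideal_F ?m i j}"
      using F.homology_mod_ideal[OF \<F> irr ij] by blast
  next
    fix u assume "u \<in> {d i v \<oplus>\<^bsub>F.F i\<^esub> w | v w. v \<in> F.F_degree (Suc i) j \<and> w \<in> F.ideal_F ?m i j}"
    then obtain v w where u: "u = d i v \<oplus>\<^bsub>F.F i\<^esub> w" and v: "v \<in> F.F_degree (Suc i) j" and w: "w \<in> F.ideal_F ?m i j"
      by blast
    have "u \<in> F.F_degree i j" unfolding u using F.d_free[OF v] ideal_times_free_free[OF w] by (rule free_degree_add)
    moreover have "d l u \<in> F.ideal_F ?m l j" if i: "i = Suc l" for l
    proof -
      interpret E: module R "F.F l" by (rule F.F_module)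
      have "d i v \<in> carrier (F.F i)" "w \<in> carrier (F.F i)"
        using F.d_free[OF v] ideal_times_free_free[OF w] free_degree_closed by blast+
      then have "d l u = d l (d i v) \<oplus>\<^bsub>F.F l\<^esub> d l w" unfolding u i by (rule F.d_add)
      moreover have dw: "d l w \<in> F.ideal_F ?m l j" using F.d_ideal_times_free[OF m] w i by blast
      moreover have "d l (d i v) = \<zero>\<^bsub>F.F l\<^esub>" using F.d_d v i by blast
      ultimately show ?thesis using free_degree_closed[OF ideal_times_free_free[OF dw]] by simp
    qed
    ultimately show "u \<in> F.cycles_mod ?m i j" by (simp add: F.cycles_mod_def split: nat.split)
  qed
qed

end

section \<open>Graded algebras of functions on two families of points\<close>

text \<open>What the argument uses of the coordinate ring: \<open>ev m x p\<close> is the value of \<open>x\<close>, of degree \<open>m\<close>, at a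
chosen vector on the line \<open>p\<close>.  The degree is an argument of \<open>ev\<close> because \<open>\<zero>\<close> lies in every degree.
Injectivity is required in positive degrees only, as it fails in degree \<open>0\<close> without any points.\<close>

locale point_algebra = graded_algebra R G for R :: "('a, 'c) ring_scheme" (structure) and G +
  fixes ev :: "nat \<Rightarrow> 'a \<Rightarrow> 'p \<Rightarrow> 'k::field" and S\<^sub>1 S\<^sub>2 :: "'p set"
  assumes finite_points: "finite S\<^sub>1" "finite S\<^sub>2"
    and ev_add: "x \<in> G m \<Longrightarrow> y \<in> G m \<Longrightarrow> p \<in> S\<^sub>1 \<union> S\<^sub>2 \<Longrightarrow> ev m (x \<oplus> y) p = ev m x p + ev m y p"
    and ev_mult: "x \<in> G m \<Longrightarrow> y \<in> G l \<Longrightarrow> p \<in> S\<^sub>1 \<union> S\<^sub>2 \<Longrightarrow> ev (m + l) (x \<otimes> y) p = ev m x p * ev l y p"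
    and ev_inj: "x \<in> G m \<Longrightarrow> 0 < m \<Longrightarrow> (\<And>p. p \<in> S\<^sub>1 \<union> S\<^sub>2 \<Longrightarrow> ev m x p = 0) \<Longrightarrow> x = \<zero>"
    and ev_const: "\<exists>a\<in>G 0. \<forall>p\<in>S\<^sub>1 \<union> S\<^sub>2. ev 0 a p = c"
    and independent\<^sub>1: "s \<in> S\<^sub>1 \<Longrightarrow> \<exists>x\<in>G 1. ev 1 x s \<noteq> 0 \<and> (\<forall>p\<in>S\<^sub>1 - {s}. ev 1 x p = 0)"
    and independent\<^sub>2: "s \<in> S\<^sub>2 \<Longrightarrow> \<exists>x\<in>G 1. ev 1 x s \<noteq> 0 \<and> (\<forall>p\<in>S\<^sub>2 - {s}. ev 1 x p = 0)"
    and separated\<^sub>1: "s \<in> S\<^sub>1 \<Longrightarrow> \<exists>x\<in>G 1. ev 1 x s \<noteq> 0 \<and> (\<forall>p\<in>S\<^sub>2. ev 1 x p = 0)"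
    and separated\<^sub>2: "s \<in> S\<^sub>2 \<Longrightarrow> \<exists>x\<in>G 1. ev 1 x s \<noteq> 0 \<and> (\<forall>p\<in>S\<^sub>1. ev 1 x p = 0)"
begin

abbreviation "S \<equiv> S\<^sub>1 \<union> S\<^sub>2"

lemma swap: "point_algebra R G ev S\<^sub>2 S\<^sub>1"
  using finite_points ev_add ev_mult ev_inj ev_const independent\<^sub>1 independent\<^sub>2 separated\<^sub>1 separated\<^sub>2
  by unfold_locales (simp_all add: Un_commute)

lemma disjoint: "s \<in> S\<^sub>1 \<Longrightarrow> s \<notin> S\<^sub>2"
  using separated\<^sub>1 by blast

lemma ev_zero: "p \<in> S \<Longrightarrow> ev m \<zero> p = 0"
  using ev_add[OF zero_in_degree zero_in_degree, of p m] by (metis add_cancel_right_right l_zero zero_closed)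

lemma ev_minus: "x \<in> G m \<Longrightarrow> p \<in> S \<Longrightarrow> ev m (\<ominus> x) p = - ev m x p"
  using ev_add[of x m "\<ominus> x" p] ev_zero[of p m] degree_minus[of x m] degree_closed[of x m]
  by (simp add: r_neg eq_neg_iff_add_eq_0 add.commute)

text \<open>A nonzero scalar is invertible; if it vanished at \<open>s\<close>, so would every element, whereas some linear
form is nonzero at \<open>s\<close>.\<close>

lemma ev_scalar_nonzero:
  assumes a: "a \<in> G 0" and s: "s \<in> S" "ev 0 a s = 0"
  shows "a = \<zero>"
proof (rule ccontr)
  assume "a \<noteq> \<zero>"
  then have "a \<in> Units (R \<lparr>carrier := G 0\<rparr>)"
    using subfield.subfield_Units[OF connected] a by simp
  then obtain b where b: "b \<in> G 0" "a \<otimes> b = \<one>" by (auto simp: Units_def)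
  obtain x where x: "x \<in> G 1" "ev 1 x s \<noteq> 0" using s independent\<^sub>1 independent\<^sub>2 by blast
  have bx: "b \<otimes> x \<in> G 1" using degree_mult[OF b(1) x(1)] by simp
  have "x = a \<otimes> (b \<otimes> x)"
    using b a x degree_closed by (metis m_assoc l_one)
  then have "ev 1 x s = ev 0 a s * ev 1 (b \<otimes> x) s" using ev_mult[OF a bx s(1)] by simp
  then show False using x s by simp
qed

text \<open>The degree \<open>0\<close> part is put to \<open>0\<close>, so that the empty set of points gives the irrelevant ideal.\<close>

definition vanishing :: "'p set \<Rightarrow> nat \<Rightarrow> 'a set" where
  "vanishing T m = (if m = 0 then {\<zero>} else {x \<in> G m. \<forall>p\<in>T. ev m x p = 0})"

text \<open>The points of \<open>S\<close> in the linear span of \<open>Q\<close>.\<close>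

definition flat :: "'p set \<Rightarrow> 'p set" where
  "flat Q = {p \<in> S. \<forall>x\<in>G 1. (\<forall>q\<in>Q. ev 1 x q = 0) \<longrightarrow> ev 1 x p = 0}"

lemma subset_flat: "Q \<subseteq> S \<Longrightarrow> Q \<subseteq> flat Q"
  by (auto simp: flat_def)

lemma flat_mono: "Q \<subseteq> Q' \<Longrightarrow> flat Q \<subseteq> flat Q'"
  by (auto simp: flat_def)

lemma flat_independent:
  assumes "T \<subseteq> S\<^sub>1"
  shows "flat T = T"
proof -
  have "p \<in> T" if p: "p \<in> flat T" for p
  proof (rule ccontr)
    assume "p \<notin> T"
    have "\<exists>x\<in>G 1. ev 1 x p \<noteq> 0 \<and> (\<forall>q\<in>T. ev 1 x q = 0)"
    proof (cases "p \<in> S\<^sub>1")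
      case True
      then show ?thesis using independent\<^sub>1[OF True] assms \<open>p \<notin> T\<close> by blast
    next
      case False
      then have "p \<in> S\<^sub>2" using p by (auto simp: flat_def)
      then show ?thesis using separated\<^sub>2 assms by blast
    qed
    then show False using p by (auto simp: flat_def)
  qed
  then show ?thesis using subset_flat[of T] assms by blast
qed

text \<open>Powers of the linear forms dual to the points of \<open>S\<^sub>1\<close> are supported at single points.\<close>

lemma interpolation\<^sub>1:
  assumes "0 < m"
  shows "\<exists>z\<in>G m. \<forall>p\<in>S\<^sub>1. ev m z p = g p"
proof -
  have power: "\<exists>y\<in>G (Suc l). ev (Suc l) y s \<noteq> 0 \<and> (\<forall>p\<in>S\<^sub>1 - {s}. ev (Suc l) y p = 0)"
    if s: "s \<in> S\<^sub>1" for s l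
  proof (induction l)
    case 0
    show ?case using independent\<^sub>1[OF s] by simp
  next
    case (Suc l)
    obtain y where y: "y \<in> G (Suc l)" "ev (Suc l) y s \<noteq> 0" "\<And>p. p \<in> S\<^sub>1 - {s} \<Longrightarrow> ev (Suc l) y p = 0"
      using Suc by blast
    obtain x where x: "x \<in> G 1" "ev 1 x s \<noteq> 0" using independent\<^sub>1[OF s] by blast
    have "ev (Suc (Suc l)) (y \<otimes> x) p = ev (Suc l) y p * ev 1 x p" if "p \<in> S\<^sub>1" for p
      using ev_mult[OF y(1) x(1), of p] that by simp
    then show ?case using degree_mult[OF y(1) x(1)] x y s by (intro bexI[of _ "y \<otimes> x"]) auto
  qed
  have point: "\<exists>y\<in>G m. ev m y s = c \<and> (\<forall>p\<in>S\<^sub>1 - {s}. ev m y p = 0)" if s: "s \<in> S\<^sub>1" for s c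
  proof -
    obtain y where y: "y \<in> G m" "ev m y s \<noteq> 0" "\<And>p. p \<in> S\<^sub>1 - {s} \<Longrightarrow> ev m y p = 0"
      using power[OF s, of "m - 1"] assms by auto
    obtain a where a: "a \<in> G 0" "\<And>p. p \<in> S \<Longrightarrow> ev 0 a p = c / ev m y s"
      using ev_const[of "c / ev m y s"] by blast
    have "ev m (a \<otimes> y) p = c / ev m y s * ev m y p" if "p \<in> S\<^sub>1" for p
      using ev_mult[OF a(1) y(1), of p] a(2)[of p] that by simp
    then show ?thesis using degree_mult[OF a(1) y(1)] y s by (intro bexI[of _ "a \<otimes> y"]) auto
  qed
  have "\<exists>z\<in>G m. \<forall>p\<in>S\<^sub>1. ev m z p = (if p \<in> T then g p else 0)" if "finite T" "T \<subseteq> S\<^sub>1" for T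
    using that
  proof (induction T rule: finite_induct)
    case empty
    then show ?case using zero_in_degree ev_zero by auto
  next
    case (insert s T)
    then obtain z where z: "z \<in> G m" "\<And>p. p \<in> S\<^sub>1 \<Longrightarrow> ev m z p = (if p \<in> T then g p else 0)" by auto
    obtain y where y: "y \<in> G m" "ev m y s = g s" "\<And>p. p \<in> S\<^sub>1 - {s} \<Longrightarrow> ev m y p = 0"
      using point[of s "g s"] insert by auto
    have "ev m (z \<oplus> y) p = (if p \<in> insert s T then g p else 0)" if p: "p \<in> S\<^sub>1" for p
      using ev_add[OF z(1) y(1), of p] z(2)[OF p] y(2) y(3)[of p] p insert by auto
    then show ?case using degree_add[OF z(1) y(1)] by blast
  qed
  from this[of S\<^sub>1] show ?thesis using finite_points by auto
qed

lemma interpolation: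
  assumes "0 < m" "T \<subseteq> S\<^sub>1 \<or> T \<subseteq> S\<^sub>2"
  shows "\<exists>z\<in>G m. \<forall>p\<in>T. ev m z p = g p"
  using interpolation\<^sub>1[OF assms(1), of g] point_algebra.interpolation\<^sub>1[OF swap assms(1), of g] assms(2)
  by blast

definition half_ideals :: "(nat \<Rightarrow> 'a set) set" where
  "half_ideals = {vanishing T | T. T \<subseteq> S\<^sub>1 \<or> T \<subseteq> S\<^sub>2}"

text \<open>If some linear form \<open>w\<close> vanishes on \<open>Q\<close> but not at \<open>s\<close>, then every linear form vanishing on \<open>Q\<close> agrees
with a multiple of \<open>w\<close> on the larger flat (\<open>linear\<close> in the proof).  Hence \<open>w\<close> vanishes at no point that
the larger flat has in excess.  So \<open>w a\<close> vanishes on the larger flat exactly when \<open>a\<close> vanishes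
at the excess points, which gives the colon ideal; and dividing by \<open>w\<close> at these points, which lie in
one half, reduces generation to interpolation.\<close>

lemma linear_filtration_remove_point:
  assumes Q: "Q \<subseteq> S" and s: "s \<in> S"
    and half: "flat (insert s Q) - flat Q \<subseteq> S\<^sub>1 \<or> flat (insert s Q) - flat Q \<subseteq> S\<^sub>2"
    and filt: "linear_filtration half_ideals (vanishing (flat (insert s Q)))"
  shows "linear_filtration half_ideals (vanishing (flat Q))"
proof (cases "\<exists>w\<in>G 1. ev 1 w s \<noteq> 0 \<and> (\<forall>q\<in>Q. ev 1 w q = 0)")
  case False
  then have "flat (insert s Q) = flat Q" by (auto simp: flat_def)
  then show ?thesis using filt by simp
next
  case True
  then obtain w where w: "w \<in> G 1" "ev 1 w s \<noteq> 0" "\<And>q. q \<in> Q \<Longrightarrow> ev 1 w q = 0" by blast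
  let ?Z = "flat Q" and ?Z' = "flat (insert s Q)"
  let ?T = "?Z' - ?Z"
  have sub: "?Z \<subseteq> ?Z'" by (rule flat_mono) blast
  have ZS: "?Z' \<subseteq> S" by (auto simp: flat_def)
  have wZ: "ev 1 w p = 0" if "p \<in> ?Z" for p using that w by (auto simp: flat_def)
  have wc: "w \<in> carrier R" using w(1) degree_closed by blast
  have linear: "\<exists>a\<in>G 0. \<forall>p\<in>?Z'. ev 1 (x \<oplus> \<ominus> (w \<otimes> a)) p = 0 \<and> ev 1 x p = ev 1 w p * ev 0 a p"
    if x: "x \<in> G 1" "\<And>q. q \<in> Q \<Longrightarrow> ev 1 x q = 0" for x
  proof -
    obtain a where a: "a \<in> G 0" "\<And>p. p \<in> S \<Longrightarrow> ev 0 a p = ev 1 x s / ev 1 w s"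
      using ev_const[of "ev 1 x s / ev 1 w s"] by blast
    have wa: "w \<otimes> a \<in> G 1" using degree_mult[OF w(1) a(1)] by simp
    have e: "ev 1 (x \<oplus> \<ominus> (w \<otimes> a)) p = ev 1 x p - ev 1 w p * ev 0 a p" if "p \<in> S" for p
      using ev_add[OF x(1) degree_minus[OF wa] that] ev_minus[OF wa that] ev_mult[OF w(1) a(1) that] by simp
    have "ev 1 (x \<oplus> \<ominus> (w \<otimes> a)) q = 0" if "q \<in> insert s Q" for q
      using e[of q] that Q s a(2)[OF s] w x by auto
    moreover have "x \<oplus> \<ominus> (w \<otimes> a) \<in> G 1" by (rule degree_add[OF x(1) degree_minus[OF wa]])
    ultimately have "ev 1 (x \<oplus> \<ominus> (w \<otimes> a)) p = 0" if "p \<in> ?Z'" for p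
      using that unfolding flat_def by blast
    moreover have "ev 1 x p = ev 1 w p * ev 0 a p" if "p \<in> ?Z'" for p
      using e[of p] calculation[OF that] that ZS by auto
    ultimately show ?thesis using a(1) by blast
  qed
  have wT: "ev 1 w p \<noteq> 0" if p: "p \<in> ?T" for p
  proof -
    obtain x where "x \<in> G 1" "\<And>q. q \<in> Q \<Longrightarrow> ev 1 x q = 0" "ev 1 x p \<noteq> 0"
      using p by (auto simp: flat_def)
    then show ?thesis using linear[of x] p by auto
  qed
  have colon: "colon (vanishing ?Z') w = vanishing ?T"
  proof
    fix m
    have ev: "ev (Suc m) (w \<otimes> a) p = ev 1 w p * ev m a p" if "a \<in> G m" "p \<in> S" for a p
      using ev_mult[OF w(1) that] by simp
    have wa: "w \<otimes> a \<in> G (Suc m)" if "a \<in> G m" for a using degree_mult[OF w(1) that] by simp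
    show "colon (vanishing ?Z') w m = vanishing ?T m"
    proof (cases "m = 0")
      case True
      have "a = \<zero>" if "a \<in> colon (vanishing ?Z') w m" for a
      proof -
        have a: "a \<in> G 0" "ev 1 (w \<otimes> a) s = 0"
          using that True subset_flat[of "insert s Q"] Q s by (auto simp: colon_def vanishing_def)
        then have "ev 0 a s = 0" using ev[of a s] True s w(2) by simp
        then show ?thesis using ev_scalar_nonzero a(1) s by blast
      qed
      moreover have "\<zero> \<in> colon (vanishing ?Z') w m"
      proof -
        have "ev (Suc m) \<zero> p = 0" if "p \<in> ?Z'" for p using ev_zero that ZS by blast
        then show ?thesis using wc by (simp add: colon_def vanishing_def zero_in_degree)
      qed
      ultimately have "colon (vanishing ?Z') w m = {\<zero>}" by blast
      moreover have "vanishing ?T m = {\<zero>}" using True by (simp add: vanishing_def)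
      ultimately show ?thesis by (rule trans[OF _ sym])
    next
      case False
      have "(\<forall>p\<in>?Z'. ev (Suc m) (w \<otimes> a) p = 0) \<longleftrightarrow> (\<forall>p\<in>?T. ev m a p = 0)" if a: "a \<in> G m" for a
      proof -
        have "ev (Suc m) (w \<otimes> a) p = 0 \<longleftrightarrow> p \<in> ?Z \<or> ev m a p = 0" if "p \<in> ?Z'" for p
        proof -
          have "ev (Suc m) (w \<otimes> a) p = ev 1 w p * ev m a p" using ev[OF a] that ZS by blast
          then show ?thesis using wZ wT that by auto
        qed
        then show ?thesis by blast
      qed
      then show ?thesis using False wa by (auto simp: colon_def vanishing_def)
    qed
  qed
  have generated: "adjoin (vanishing ?Z') w = vanishing ?Z"
  proof
    fix m
    show "adjoin (vanishing ?Z') w m = vanishing ?Z m"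
    proof (cases m)
      case 0
      then show ?thesis by (simp add: adjoin_def vanishing_def)
    next
      case (Suc l)
      show ?thesis
      proof (intro equalityI subsetI)
        fix u assume "u \<in> adjoin (vanishing ?Z') w m"
        then obtain x z where u: "u = x \<oplus> w \<otimes> z" and x: "x \<in> G (Suc l)" "\<And>p. p \<in> ?Z' \<Longrightarrow> ev (Suc l) x p = 0"
          and z: "z \<in> G l"
          by (auto simp: adjoin_def vanishing_def Suc)
        have wz: "w \<otimes> z \<in> G (Suc l)" using degree_mult[OF w(1) z] by simp
        have "ev (Suc l) u p = 0" if p: "p \<in> ?Z" for p
        proof -
          have pS: "p \<in> ?Z'" "p \<in> S" using p sub ZS by blast+
          show ?thesis
            using ev_add[OF x(1) wz pS(2)] ev_mult[OF w(1) z pS(2)] x(2)[OF pS(1)] wZ[OF p] u by simp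
        qed
        then show "u \<in> vanishing ?Z m" using degree_add[OF x(1) wz] u Suc by (simp add: vanishing_def)
      next
        fix u assume "u \<in> vanishing ?Z m"
        then have u: "u \<in> G (Suc l)" "\<And>p. p \<in> ?Z \<Longrightarrow> ev (Suc l) u p = 0" by (auto simp: Suc vanishing_def)
        \<comment> \<open>In degree one the multiplier of \<open>w\<close> has to be a scalar, which interpolation cannot give;
          there \<open>linear\<close> applies.\<close>
        have "\<exists>z\<in>G l. \<forall>p\<in>?Z'. ev (Suc l) (u \<oplus> \<ominus> (w \<otimes> z)) p = 0"
        proof (cases "l = 0")
          case True
          then have u1: "u \<in> G 1" "\<And>q. q \<in> Q \<Longrightarrow> ev 1 u q = 0"
            using u subset_flat[OF Q] by auto
          from linear[OF this] show ?thesis unfolding True One_nat_def by blast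
        next
          case False
          then obtain z where z: "z \<in> G l" "\<And>p. p \<in> ?T \<Longrightarrow> ev l z p = ev (Suc l) u p / ev 1 w p"
            using interpolation[OF _ half, of l "\<lambda>p. ev (Suc l) u p / ev 1 w p"] by auto
          have wz: "w \<otimes> z \<in> G (Suc l)" using degree_mult[OF w(1) z(1)] by simp
          have "ev (Suc l) (u \<oplus> \<ominus> (w \<otimes> z)) p = 0" if p: "p \<in> ?Z'" for p
          proof -
            have pS: "p \<in> S" using p ZS by blast
            have "ev (Suc l) (u \<oplus> \<ominus> (w \<otimes> z)) p = ev (Suc l) u p - ev 1 w p * ev l z p"
              using ev_add[OF u(1) degree_minus[OF wz] pS] ev_minus[OF wz pS] ev_mult[OF w(1) z(1) pS] by simp
            then show ?thesis using u(2)[of p] wZ[of p] wT[of p] z(2)[of p] p by (cases "p \<in> ?Z") auto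
          qed
          then show ?thesis using z by blast
        qed
        then obtain z where z: "z \<in> G l" "\<And>p. p \<in> ?Z' \<Longrightarrow> ev (Suc l) (u \<oplus> \<ominus> (w \<otimes> z)) p = 0" by blast
        have wz: "w \<otimes> z \<in> G (Suc l)" using degree_mult[OF w(1) z(1)] by simp
        have "u = (u \<oplus> \<ominus> (w \<otimes> z)) \<oplus> w \<otimes> z"
          using degree_closed[OF u(1)] degree_closed[OF wz] by (simp add: a_assoc l_neg)
        moreover have "u \<oplus> \<ominus> (w \<otimes> z) \<in> vanishing ?Z' m"
          using z(2) degree_add[OF u(1) degree_minus[OF wz]] Suc by (simp add: vanishing_def)
        ultimately show "u \<in> adjoin (vanishing ?Z') w m" using z(1) Suc unfolding adjoin_def by auto
      qed
    qed
  qed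
  have "colon (vanishing ?Z') w \<in> half_ideals" unfolding colon half_ideals_def using half by blast
  from linear_filtration.adjoin[OF filt w(1) this] show ?thesis by (simp add: generated)
qed

text \<open>The two inductions remove first \<open>S\<^sub>2\<close> and then \<open>S\<^sub>1 - T\<close> from \<open>S\<close>.  In the first one all flats contain
\<open>S\<^sub>1\<close>, so the excess points lie in \<open>S\<^sub>2\<close>; in the second one all flats are subsets of \<open>S\<^sub>1\<close>.\<close>

lemma linear_filtration_half:
  assumes "T \<subseteq> S\<^sub>1"
  shows "linear_filtration half_ideals (vanishing T)"
proof -
  have "linear_filtration half_ideals (vanishing (flat (S - U)))" if "finite U" "U \<subseteq> S\<^sub>2" for U
    using that
  proof (induction U rule: finite_induct)
    case empty
    have "flat S = S" using subset_flat by (auto simp: flat_def)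
    moreover have "vanishing S = (\<lambda>m. {\<zero>})"
      using ev_inj zero_in_degree ev_zero by (auto simp: vanishing_def fun_eq_iff)
    ultimately show ?case using linear_filtration.zero by simp
  next
    case (insert s U)
    let ?Q = "S - insert s U"
    have Q: "insert s ?Q = S - U" using insert by blast
    have "S\<^sub>1 \<subseteq> flat ?Q" using subset_flat[of ?Q] disjoint insert by blast
    then have "flat (insert s ?Q) - flat ?Q \<subseteq> S\<^sub>2" by (auto simp: flat_def)
    moreover have "linear_filtration half_ideals (vanishing (flat (insert s ?Q)))"
      unfolding Q using insert by simp
    ultimately show ?case using insert by (intro linear_filtration_remove_point[of ?Q s]) auto
  qed
  moreover have "S - S\<^sub>2 = S\<^sub>1" using disjoint by blast
  ultimately have base: "linear_filtration half_ideals (vanishing (flat S\<^sub>1))"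
    using finite_points by (metis order_refl)
  have "linear_filtration half_ideals (vanishing (flat (S\<^sub>1 - U)))" if "finite U" "U \<subseteq> S\<^sub>1" for U
    using that
  proof (induction U rule: finite_induct)
    case empty
    then show ?case using base by simp
  next
    case (insert s U)
    let ?Q = "S\<^sub>1 - insert s U"
    have Q: "insert s ?Q = S\<^sub>1 - U" using insert by blast
    have "flat (S\<^sub>1 - U) = S\<^sub>1 - U" by (rule flat_independent) blast
    then have "flat (insert s ?Q) - flat ?Q \<subseteq> S\<^sub>1" unfolding Q by blast
    moreover have "linear_filtration half_ideals (vanishing (flat (insert s ?Q)))"
      unfolding Q using insert by simp
    ultimately show ?case using insert by (intro linear_filtration_remove_point[of ?Q s]) auto
  qed
  from this[of "S\<^sub>1 - T"] show ?thesis
    using flat_independent[OF assms] assms finite_points by (simp add: double_diff)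
qed

theorem koszul: "koszul R G"
proof (rule koszul_if_linear_filtrations)
  interpret swapped: point_algebra R G ev S\<^sub>2 S\<^sub>1 by (rule swap)
  have eq: "swapped.half_ideals = half_ideals"
    by (auto simp: swapped.half_ideals_def half_ideals_def)
  show "linear_filtration half_ideals K" if "K \<in> half_ideals" for K
    using that linear_filtration_half swapped.linear_filtration_half unfolding eq
    by (auto simp: half_ideals_def)
  have "irrelevant_degree = vanishing {}"
    by (auto simp: irrelevant_degree_def vanishing_def fun_eq_iff)
  then show "irrelevant_degree \<in> half_ideals" unfolding half_ideals_def by blast
qed

end

section \<open>Homogeneous parts and evaluation of polynomials\<close>

abbreviation monomial_degree :: "('n::finite \<Rightarrow>\<^sub>0 nat) \<Rightarrow> nat" where
  "monomial_degree t \<equiv> (\<Sum>i\<in>UNIV. Poly_Mapping.lookup t i)"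

lemma homogeneous_iff: "homogeneous m f \<longleftrightarrow> (\<forall>t. Poly_Mapping.lookup f t \<noteq> 0 \<longrightarrow> monomial_degree t = m)"
  by (auto simp: homogeneous_def in_keys_iff)

lemma homogeneous_zero: "homogeneous m 0"
  by (simp add: homogeneous_iff)

lemma homogeneous_add: "homogeneous m f \<Longrightarrow> homogeneous m g \<Longrightarrow> homogeneous m (f + g)"
  unfolding homogeneous_iff lookup_add by (metis add.left_neutral)

lemma homogeneous_uminus: "homogeneous m f \<Longrightarrow> homogeneous m (- f)"
  by (simp add: homogeneous_iff)

lemma homogeneous_diff: "homogeneous m f \<Longrightarrow> homogeneous m g \<Longrightarrow> homogeneous m (f - g)"
  using homogeneous_add[of m f "- g"] homogeneous_uminus[of m g] by simp

lemma monomial_degree_add: "monomial_degree (s + t) = monomial_degree s + monomial_degree t"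
  by (simp add: lookup_add sum.distrib)

lemma homogeneous_mult:
  assumes "homogeneous m f" "homogeneous l g"
  shows "homogeneous (m + l) (f * g)"
  unfolding homogeneous_def
proof
  fix t assume "t \<in> Poly_Mapping.keys (f * g)"
  then obtain a b where "t = a + b" "a \<in> Poly_Mapping.keys f" "b \<in> Poly_Mapping.keys g"
    using keys_mult[of f g] by blast
  then show "monomial_degree t = m + l"
    using assms by (simp only: monomial_degree_add homogeneous_def)
qed

lemma homogeneous_single: "homogeneous (monomial_degree t) (Poly_Mapping.single t c)"
  by (simp add: homogeneous_def)

lemma homogeneous_0_iff: "homogeneous 0 f \<longleftrightarrow> (\<exists>c. f = Poly_Mapping.single 0 c)"
proof
  assume f: "homogeneous 0 f"
  have "f = Poly_Mapping.single 0 (Poly_Mapping.lookup f 0)"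
  proof (rule poly_mapping_eqI)
    fix t
    show "Poly_Mapping.lookup f t = Poly_Mapping.lookup (Poly_Mapping.single 0 (Poly_Mapping.lookup f 0)) t"
    proof (cases "t = 0")
      case False
      then have "monomial_degree t \<noteq> 0"
        by (metis (no_types, lifting) UNIV_I finite lookup_zero poly_mapping_eqI sum_eq_0_iff)
      then show ?thesis using f False by (auto simp: homogeneous_iff lookup_single)
    qed simp
  qed
  then show "\<exists>c. f = Poly_Mapping.single 0 c" by blast
next
  assume "\<exists>c. f = Poly_Mapping.single 0 c"
  then show "homogeneous 0 f" using homogeneous_single[of 0] by auto
qed

lemma polynomial_eq_sum_monomials:
  assumes "finite T" "Poly_Mapping.keys f \<subseteq> T"
  shows "f = (\<Sum>t\<in>T. Poly_Mapping.single t (Poly_Mapping.lookup f t))"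
proof (rule poly_mapping_eqI)
  fix s
  have "(\<Sum>t\<in>T. Poly_Mapping.lookup (Poly_Mapping.single t (Poly_Mapping.lookup f t)) s) =
      (\<Sum>t\<in>T. if t = s then Poly_Mapping.lookup f s else 0)"
    by (rule sum.cong) (auto simp: lookup_single)
  also have "\<dots> = Poly_Mapping.lookup f s"
    using assms by (auto simp: in_keys_iff sum.delta)
  finally show "Poly_Mapping.lookup f s =
      Poly_Mapping.lookup (\<Sum>t\<in>T. Poly_Mapping.single t (Poly_Mapping.lookup f t)) s"
    by (simp add: lookup_sum)
qed

definition homogeneous_part :: "nat \<Rightarrow> ('k::field, 'n::finite) mpoly \<Rightarrow> ('k, 'n) mpoly" where
  "homogeneous_part m f =
    (\<Sum>t\<in>{t \<in> Poly_Mapping.keys f. monomial_degree t = m}. Poly_Mapping.single t (Poly_Mapping.lookup f t))"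

lemma lookup_homogeneous_part:
  "Poly_Mapping.lookup (homogeneous_part m f) s = (if monomial_degree s = m then Poly_Mapping.lookup f s else 0)"
proof -
  have "Poly_Mapping.lookup (homogeneous_part m f) s =
      (\<Sum>t\<in>{t \<in> Poly_Mapping.keys f. monomial_degree t = m}. if t = s then Poly_Mapping.lookup f s else 0)"
    unfolding homogeneous_part_def lookup_sum by (rule sum.cong) (auto simp: lookup_single)
  also have "\<dots> = (if monomial_degree s = m then Poly_Mapping.lookup f s else 0)"
    by (auto simp: in_keys_iff sum.delta)
  finally show ?thesis .
qed

lemma homogeneous_homogeneous_part: "homogeneous m (homogeneous_part m f)"
  by (simp add: homogeneous_iff lookup_homogeneous_part)

lemma homogeneous_part_zero: "homogeneous_part m 0 = 0"
  by (rule poly_mapping_eqI) (simp add: lookup_homogeneous_part)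

lemma homogeneous_part_add: "homogeneous_part m (f + g) = homogeneous_part m f + homogeneous_part m g"
  by (rule poly_mapping_eqI) (simp add: lookup_homogeneous_part lookup_add)

lemma homogeneous_part_uminus: "homogeneous_part m (- f) = - homogeneous_part m f"
  by (rule poly_mapping_eqI) (simp add: lookup_homogeneous_part)

lemma homogeneous_part_diff: "homogeneous_part m (f - g) = homogeneous_part m f - homogeneous_part m g"
  by (rule poly_mapping_eqI) (simp add: lookup_homogeneous_part lookup_minus)

lemma homogeneous_part_sum: "homogeneous_part m (sum h T) = (\<Sum>x\<in>T. homogeneous_part m (h x))"
  by (induction T rule: infinite_finite_induct) (simp_all add: homogeneous_part_zero homogeneous_part_add)

lemma homogeneous_part_homogeneous:
  "homogeneous l f \<Longrightarrow> homogeneous_part m f = (if m = l then f else 0)"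
  by (rule poly_mapping_eqI) (auto simp: lookup_homogeneous_part homogeneous_iff)

lemma homogeneous_part_nonzero: "{m. homogeneous_part m f \<noteq> 0} \<subseteq> monomial_degree ` Poly_Mapping.keys f"
proof
  fix m assume "m \<in> {m. homogeneous_part m f \<noteq> 0}"
  then obtain t where "Poly_Mapping.lookup (homogeneous_part m f) t \<noteq> 0"
    by (metis (mono_tags) lookup_zero mem_Collect_eq poly_mapping_eqI)
  then show "m \<in> monomial_degree ` Poly_Mapping.keys f"
    by (auto simp: lookup_homogeneous_part in_keys_iff split: if_splits)
qed

lemma sum_homogeneous_parts:
  assumes "finite T" "{m. homogeneous_part m f \<noteq> 0} \<subseteq> T"
  shows "f = (\<Sum>m\<in>T. homogeneous_part m f)"
proof (rule poly_mapping_eqI)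
  fix s
  have "Poly_Mapping.lookup (\<Sum>m\<in>T. homogeneous_part m f) s =
      (\<Sum>m\<in>T. if m = monomial_degree s then Poly_Mapping.lookup f s else 0)"
    unfolding lookup_sum by (rule sum.cong) (auto simp: lookup_homogeneous_part)
  also have "\<dots> = (if monomial_degree s \<in> T then Poly_Mapping.lookup f s else 0)"
    using assms(1) by (simp add: sum.delta)
  also have "\<dots> = Poly_Mapping.lookup f s"
  proof (cases "monomial_degree s \<in> T")
    case False
    then have "homogeneous_part (monomial_degree s) f = 0" using assms(2) by blast
    then have "Poly_Mapping.lookup (homogeneous_part (monomial_degree s) f) s = 0" by simp
    then show ?thesis using False by (simp add: lookup_homogeneous_part)
  qed simp
  finally show "Poly_Mapping.lookup f s = Poly_Mapping.lookup (\<Sum>m\<in>T. homogeneous_part m f) s" by simp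
qed

lemma poly_eval_superset:
  assumes "finite T" "Poly_Mapping.keys f \<subseteq> T"
  shows "poly_eval f v = (\<Sum>t\<in>T. Poly_Mapping.lookup f t * (\<Prod>i\<in>UNIV. (v $ i) ^ Poly_Mapping.lookup t i))"
  unfolding poly_eval_def using assms by (intro sum.mono_neutral_left) (auto simp: in_keys_iff)

lemma poly_eval_zero: "poly_eval 0 v = 0"
  by (simp add: poly_eval_def)

lemma poly_eval_add: "poly_eval (f + g) v = poly_eval f v + poly_eval g v"
proof -
  have "poly_eval h v = (\<Sum>t\<in>Poly_Mapping.keys f \<union> Poly_Mapping.keys g.
      Poly_Mapping.lookup h t * (\<Prod>i\<in>UNIV. (v $ i) ^ Poly_Mapping.lookup t i))" if "h \<in> {f, g, f + g}" for h
    using that keys_add[of f g] by (intro poly_eval_superset) auto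
  then show ?thesis by (simp add: lookup_add distrib_right sum.distrib)
qed

lemma poly_eval_sum: "poly_eval (sum h T) v = (\<Sum>x\<in>T. poly_eval (h x) v)"
  by (induction T rule: infinite_finite_induct) (simp_all add: poly_eval_zero poly_eval_add)

lemma poly_eval_uminus: "poly_eval (- f) v = - poly_eval f v"
  using poly_eval_add[of f "- f" v] by (simp add: poly_eval_zero eq_neg_iff_add_eq_0 add.commute)

lemma poly_eval_diff: "poly_eval (f - g) v = poly_eval f v - poly_eval g v"
  using poly_eval_add[of f "- g" v] by (simp add: poly_eval_uminus)

lemma poly_eval_single:
  "poly_eval (Poly_Mapping.single t c) v = c * (\<Prod>i\<in>UNIV. (v $ i) ^ Poly_Mapping.lookup t i)"
  using poly_eval_superset[of "{t}" "Poly_Mapping.single t c" v] by simp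

lemma poly_eval_mult: "poly_eval (f * g) v = poly_eval f v * poly_eval g v"
proof -
  let ?e = "\<lambda>t. \<Prod>i\<in>UNIV. (v $ i) ^ Poly_Mapping.lookup t i"
  have "f * g = (\<Sum>t\<in>Poly_Mapping.keys f. Poly_Mapping.single t (Poly_Mapping.lookup f t)) *
      (\<Sum>t\<in>Poly_Mapping.keys g. Poly_Mapping.single t (Poly_Mapping.lookup g t))"
    using polynomial_eq_sum_monomials[of "Poly_Mapping.keys f" f] polynomial_eq_sum_monomials[of "Poly_Mapping.keys g" g]
    by simp
  then have fg: "f * g = (\<Sum>s\<in>Poly_Mapping.keys f. \<Sum>t\<in>Poly_Mapping.keys g.
      Poly_Mapping.single (s + t) (Poly_Mapping.lookup f s * Poly_Mapping.lookup g t))"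
    by (simp add: sum_product mult_single)
  have e: "?e (s + t) = ?e s * ?e t" for s t
    by (simp add: lookup_add power_add prod.distrib)
  show ?thesis
    unfolding fg poly_eval_sum poly_eval_single e
    by (simp add: poly_eval_def sum_product mult_ac)
qed

text \<open>The case distinction accounts for the convention for the empty set; in both cases these are the
homogeneous elements of the vanishing ideal, see \<open>homogeneous_in_vanishing_ideal\<close>.\<close>

definition vanishes :: "('k::field ^ 'n::finite) set set \<Rightarrow> nat \<Rightarrow> ('k, 'n) mpoly \<Rightarrow> bool" where
  "vanishes S m f \<longleftrightarrow> homogeneous m f \<and>
    (if S = {} then 0 < m \<or> f = 0 else \<forall>p\<in>S. \<forall>v\<in>p. poly_eval f v = 0)"

lemma vanishes_homogeneous: "vanishes S m f \<Longrightarrow> homogeneous m f"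
  by (simp add: vanishes_def)

lemma vanishes_zero: "vanishes S m 0"
  by (simp add: vanishes_def homogeneous_zero poly_eval_zero)

lemma vanishes_add: "vanishes S m f \<Longrightarrow> vanishes S m g \<Longrightarrow> vanishes S m (f + g)"
  by (auto simp: vanishes_def homogeneous_add poly_eval_add)

lemma vanishes_uminus: "vanishes S m f \<Longrightarrow> vanishes S m (- f)"
  by (auto simp: vanishes_def homogeneous_uminus poly_eval_uminus)

lemma vanishes_sum: "(\<And>x. x \<in> T \<Longrightarrow> vanishes S m (h x)) \<Longrightarrow> vanishes S m (sum h T)"
  by (induction T rule: infinite_finite_induct) (simp_all add: vanishes_zero vanishes_add)

lemma vanishes_mult: "homogeneous l g \<Longrightarrow> vanishes S m f \<Longrightarrow> vanishes S (l + m) (g * f)"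
  by (auto simp: vanishes_def homogeneous_mult poly_eval_mult)

lemma polynomial_ring_simps [simp]:
  "carrier polynomial_ring = UNIV" "f \<otimes>\<^bsub>polynomial_ring\<^esub> g = f * g" "\<one>\<^bsub>polynomial_ring\<^esub> = 1"
  "\<zero>\<^bsub>polynomial_ring\<^esub> = 0" "f \<oplus>\<^bsub>polynomial_ring\<^esub> g = f + g"
  by (simp_all add: polynomial_ring_def)

lemma cring_polynomial_ring: "cring polynomial_ring"
proof (rule cringI)
  show "abelian_group polynomial_ring"
    by (rule abelian_groupI) (auto simp: add_ac intro: exI[of _ "- x" for x])
  show "comm_monoid polynomial_ring"
    by (rule comm_monoidI) (auto simp: mult_ac)
qed (auto simp: distrib_right)

lemma polynomial_ring_minus [simp]: "\<ominus>\<^bsub>polynomial_ring\<^esub> f = - f"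
proof -
  interpret cring polynomial_ring by (rule cring_polynomial_ring)
  show ?thesis using minus_equality[of "- f" f] by simp
qed

lemma vanishing_ideal_eq: "vanishing_ideal S = Idl\<^bsub>polynomial_ring\<^esub> {f. \<exists>m. vanishes S m f}"
proof (cases "S = {}")
  case True
  have "{f. \<exists>m>0. homogeneous m f} = {f. \<exists>m. vanishes S m f}"
    using True homogeneous_zero by (auto simp: vanishes_def intro: exI[of _ 1])
  then show ?thesis using True by (simp add: vanishing_ideal_def)
next
  case False
  then show ?thesis by (simp add: vanishing_ideal_def vanishes_def)
qed

lemma ideal_vanishing_ideal: "ideal (vanishing_ideal S) polynomial_ring"
proof -
  interpret cring polynomial_ring by (rule cring_polynomial_ring)
  show ?thesis unfolding vanishing_ideal_eq by (rule genideal_ideal) simp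
qed

lemma vanishes_in_ideal: "vanishes S m f \<Longrightarrow> f \<in> vanishing_ideal S"
proof -
  interpret cring polynomial_ring by (rule cring_polynomial_ring)
  show "vanishes S m f \<Longrightarrow> f \<in> vanishing_ideal S"
    using genideal_self[of "{f. \<exists>m. vanishes S m f}"] unfolding vanishing_ideal_eq by auto
qed

text \<open>The vanishing ideal is generated by homogeneous elements, hence homogeneous: the polynomials whose
homogeneous parts all vanish form an ideal that contains the generators.\<close>

lemma vanishing_ideal_iff: "f \<in> vanishing_ideal S \<longleftrightarrow> (\<forall>m. vanishes S m (homogeneous_part m f))"
proof
  interpret cring polynomial_ring by (rule cring_polynomial_ring)
  define J where "J = {f. \<forall>m. vanishes S m (homogeneous_part m f)}"
  have mult: "g * f \<in> J" if f: "f \<in> J" for f g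
  proof -
    let ?T = "\<lambda>f. monomial_degree ` Poly_Mapping.keys f"
    have "g * f = (\<Sum>l\<in>?T g. homogeneous_part l g) * (\<Sum>k\<in>?T f. homogeneous_part k f)"
      using sum_homogeneous_parts[OF _ homogeneous_part_nonzero, of f]
        sum_homogeneous_parts[OF _ homogeneous_part_nonzero, of g] by simp
    then have gf: "g * f = (\<Sum>l\<in>?T g. \<Sum>k\<in>?T f. homogeneous_part l g * homogeneous_part k f)"
      by (simp add: sum_product)
    have "vanishes S m (homogeneous_part m (homogeneous_part l g * homogeneous_part k f))" for m l k
    proof -
      have "vanishes S (l + k) (homogeneous_part l g * homogeneous_part k f)"
        using f by (intro vanishes_mult homogeneous_homogeneous_part) (simp add: J_def)
      then show ?thesis
        using homogeneous_part_homogeneous[OF vanishes_homogeneous] vanishes_zero by metis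
    qed
    then have "vanishes S m (homogeneous_part m (g * f))" for m
      by (simp only: gf homogeneous_part_sum vanishes_sum)
    then show ?thesis by (simp add: J_def)
  qed
  have "ideal J polynomial_ring"
  proof (rule idealI)
    show "ring polynomial_ring" by (rule ring_axioms)
    show "subgroup J (add_monoid polynomial_ring)"
    proof (rule add.subgroupI)
      have "0 \<in> J" by (simp add: J_def vanishes_zero homogeneous_part_zero)
      then show "J \<noteq> {}" by blast
    qed (auto simp: J_def homogeneous_part_add homogeneous_part_uminus vanishes_add vanishes_uminus)
    show "g \<otimes>\<^bsub>polynomial_ring\<^esub> f \<in> J" if "f \<in> J" for f g using mult[OF that] by simp
    then show "f \<otimes>\<^bsub>polynomial_ring\<^esub> g \<in> J" if "f \<in> J" for f g using that by (simp add: mult.commute)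
  qed
  moreover have "{f. \<exists>m. vanishes S m f} \<subseteq> J"
    by (auto simp: J_def homogeneous_part_homogeneous[OF vanishes_homogeneous] vanishes_zero)
  ultimately have "vanishing_ideal S \<subseteq> J" unfolding vanishing_ideal_eq by (rule genideal_minimal)
  then show "\<forall>m. vanishes S m (homogeneous_part m f)" if "f \<in> vanishing_ideal S"
    using that by (auto simp: J_def)
next
  interpret cring polynomial_ring by (rule cring_polynomial_ring)
  interpret I: ideal "vanishing_ideal S" polynomial_ring by (rule ideal_vanishing_ideal)
  assume f: "\<forall>m. vanishes S m (homogeneous_part m f)"
  have "(\<Sum>m\<in>T. homogeneous_part m f) \<in> vanishing_ideal S" if "finite T" for T
    using that
  proof (induction T rule: finite_induct)
    case empty
    then show ?case using I.zero_closed by simp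
  next
    case (insert m T)
    then show ?case using I.a_closed[OF vanishes_in_ideal insert.IH] f by auto
  qed
  then show "f \<in> vanishing_ideal S"
    using sum_homogeneous_parts[OF _ homogeneous_part_nonzero, of f] by (metis finite_imageI finite_keys)
qed

lemma homogeneous_in_vanishing_ideal:
  "homogeneous m f \<Longrightarrow> f \<in> vanishing_ideal S \<longleftrightarrow> vanishes S m f"
  using vanishing_ideal_iff vanishes_in_ideal homogeneous_part_homogeneous by metis


definition coset :: "('k::field ^ 'n::finite) set set \<Rightarrow> ('k, 'n) mpoly \<Rightarrow> ('k, 'n) mpoly set" where
  "coset S f = vanishing_ideal S +>\<^bsub>polynomial_ring\<^esub> f"

lemma cring_coordinate_ring: "cring (coordinate_ring S)"
proof -
  interpret I: ideal "vanishing_ideal S" polynomial_ring by (rule ideal_vanishing_ideal)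
  show ?thesis unfolding coordinate_ring_def
    by (rule I.quotient_is_cring) (rule cring_polynomial_ring)
qed

lemma coset_eq_iff: "coset S f = coset S g \<longleftrightarrow> f - g \<in> vanishing_ideal S"
proof -
  interpret cring polynomial_ring by (rule cring_polynomial_ring)
  have "f \<ominus>\<^bsub>polynomial_ring\<^esub> g = f - g" by (simp add: minus_eq)
  then show ?thesis
    using quotient_eq_iff_same_a_r_cos[OF ideal_vanishing_ideal, of f g S] by (simp add: coset_def)
qed

lemma
  shows coset_add: "coset S f \<oplus>\<^bsub>coordinate_ring S\<^esub> coset S g = coset S (f + g)"
    and coset_mult: "coset S f \<otimes>\<^bsub>coordinate_ring S\<^esub> coset S g = coset S (f * g)"
    and coset_one: "\<one>\<^bsub>coordinate_ring S\<^esub> = coset S 1"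
    and coset_zero: "\<zero>\<^bsub>coordinate_ring S\<^esub> = coset S 0"
    and coset_carrier: "carrier (coordinate_ring S) = range (coset S)"
proof -
  interpret P: cring polynomial_ring by (rule cring_polynomial_ring)
  interpret I: ideal "vanishing_ideal S" polynomial_ring by (rule ideal_vanishing_ideal)
  interpret Q: cring "coordinate_ring S" by (rule cring_coordinate_ring)
  have hom: "coset S \<in> ring_hom polynomial_ring (coordinate_ring S)"
    using I.rcos_ring_hom unfolding coordinate_ring_def coset_def[abs_def] .
  show "coset S f \<oplus>\<^bsub>coordinate_ring S\<^esub> coset S g = coset S (f + g)"
    using ring_hom_add[OF hom, of f g] by simp
  show "coset S f \<otimes>\<^bsub>coordinate_ring S\<^esub> coset S g = coset S (f * g)"
    using ring_hom_mult[OF hom, of f g] by simp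
  show "\<one>\<^bsub>coordinate_ring S\<^esub> = coset S 1" using ring_hom_one[OF hom] by simp
  show "\<zero>\<^bsub>coordinate_ring S\<^esub> = coset S 0"
    using ring_hom_zero[OF hom P.ring_axioms Q.ring_axioms] by simp
  show "carrier (coordinate_ring S) = range (coset S)"
    by (auto simp: coordinate_ring_def FactRing_def A_RCOSETS_def' coset_def)
qed

lemma coset_uminus: "\<ominus>\<^bsub>coordinate_ring S\<^esub> coset S f = coset S (- f)"
proof -
  interpret Q: cring "coordinate_ring S" by (rule cring_coordinate_ring)
  show ?thesis by (rule Q.minus_equality) (simp_all add: coset_add coset_zero coset_carrier)
qed

lemma coset_finsum: "finsum (coordinate_ring S) (\<lambda>x. coset S (h x)) T = coset S (sum h T)" if "finite T"
proof -
  interpret Q: cring "coordinate_ring S" by (rule cring_coordinate_ring)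
  show ?thesis using that
  proof (induction T rule: finite_induct)
    case (insert x T)
    then show ?case by (subst Q.finsum_insert) (auto simp: coset_carrier coset_add)
  qed (simp add: coset_zero)
qed

lemma coset_eq_zero: "homogeneous m f \<Longrightarrow> coset S f = \<zero>\<^bsub>coordinate_ring S\<^esub> \<longleftrightarrow> vanishes S m f"
  by (simp add: coset_zero coset_eq_iff homogeneous_in_vanishing_ideal)

lemma coordinate_degree_eq: "coordinate_degree S m = coset S ` {f. homogeneous m f}"
  by (simp add: coordinate_degree_def coset_def[abs_def])

lemma vanishing_constant:
  assumes "\<And>p. p \<in> S \<Longrightarrow> p \<noteq> {}" and "vanishes S 0 (Poly_Mapping.single 0 c)"
  shows "c = 0"
proof (cases "S = {}")
  case True
  then show ?thesis using assms(2) by (simp add: vanishes_def) (metis lookup_single_eq lookup_zero)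
next
  case False
  then obtain p v where "p \<in> S" "v \<in> p" using assms(1) by blast
  then have "poly_eval (Poly_Mapping.single 0 c) v = 0" using assms(2) False by (simp add: vanishes_def)
  then show ?thesis by (simp add: poly_eval_single)
qed

text \<open>Since the vanishing ideal is homogeneous, decompositions into homogeneous parts descend to the
quotient.  The degree \<open>0\<close> part is the ground field, as a nonzero constant does not vanish at a
point.  Nonemptiness of the members of \<open>S\<close> ensures that there are vectors to evaluate at.\<close>

theorem graded_algebra_coordinate_ring:
  assumes "\<And>p. p \<in> S \<Longrightarrow> p \<noteq> {}"
  shows "graded_algebra (coordinate_ring S) (coordinate_degree S)"
proof -
  interpret Q: cring "coordinate_ring S" by (rule cring_coordinate_ring)
  let ?R = "coordinate_ring S" and ?G = "coordinate_degree S"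
  have GI: "homogeneous m f \<Longrightarrow> coset S f \<in> ?G m" for m f by (auto simp: coordinate_degree_eq)
  have sub: "additive_subgroup (?G m) ?R" for m
  proof (rule additive_subgroup.intro, rule Q.add.subgroupI)
    show "?G m \<subseteq> carrier ?R" by (auto simp: coordinate_degree_eq coset_carrier)
    show "?G m \<noteq> {}" using homogeneous_zero by (auto simp: coordinate_degree_eq)
    show "\<ominus>\<^bsub>?R\<^esub> x \<in> ?G m" if "x \<in> ?G m" for x
      using that by (auto simp: coordinate_degree_eq coset_uminus intro: homogeneous_uminus)
    show "x \<oplus>\<^bsub>?R\<^esub> y \<in> ?G m" if "x \<in> ?G m" "y \<in> ?G m" for x y
      using that by (auto simp: coordinate_degree_eq coset_add intro: homogeneous_add)
  qed
  have mult: "x \<otimes>\<^bsub>?R\<^esub> y \<in> ?G (m + l)" if "x \<in> ?G m" "y \<in> ?G l" for x y m l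
    using that by (auto simp: coordinate_degree_eq coset_mult intro: homogeneous_mult)
  have decomposition: "\<exists>!c. (\<forall>m. c m \<in> ?G m) \<and> finite {m. c m \<noteq> \<zero>\<^bsub>?R\<^esub>} \<and> x = finsum ?R c {m. c m \<noteq> \<zero>\<^bsub>?R\<^esub>}"
    if xc: "x \<in> carrier ?R" for x
  proof -
    obtain f where x: "x = coset S f" using xc by (auto simp: coset_carrier)
    define c where "c m = coset S (homogeneous_part m f)" for m
    let ?T = "monomial_degree ` Poly_Mapping.keys f"
    have supp: "{m. c m \<noteq> \<zero>\<^bsub>?R\<^esub>} \<subseteq> ?T"
    proof
      fix m assume "m \<in> {m. c m \<noteq> \<zero>\<^bsub>?R\<^esub>}"
      then have "homogeneous_part m f \<noteq> 0" by (metis (mono_tags) c_def coset_zero mem_Collect_eq)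
      then show "m \<in> ?T" using homogeneous_part_nonzero[of f] by blast
    qed
    have "finsum ?R c {m. c m \<noteq> \<zero>\<^bsub>?R\<^esub>} = finsum ?R c ?T"
      using supp by (intro Q.add.finprod_mono_neutral_cong_left) (auto simp: c_def coset_carrier)
    also have "\<dots> = x"
      using sum_homogeneous_parts[OF _ homogeneous_part_nonzero, of f]
      unfolding c_def[abs_def] by (simp add: coset_finsum x)
    finally have c: "(\<forall>m. c m \<in> ?G m) \<and> finite {m. c m \<noteq> \<zero>\<^bsub>?R\<^esub>} \<and> x = finsum ?R c {m. c m \<noteq> \<zero>\<^bsub>?R\<^esub>}"
      using finite_subset[OF supp] GI[OF homogeneous_homogeneous_part] by (simp add: c_def)
    have "c' = c" if c': "\<forall>m. c' m \<in> ?G m" and fin: "finite {m. c' m \<noteq> \<zero>\<^bsub>?R\<^esub>}"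
      and x': "x = finsum ?R c' {m. c' m \<noteq> \<zero>\<^bsub>?R\<^esub>}" for c'
    proof
      fix l
      \<comment> \<open>The competing decomposition is lifted to polynomials, the zero coset to \<open>0\<close>, so that the
        lifts have the same finite support.\<close>
      define h where "h m = (if c' m = \<zero>\<^bsub>?R\<^esub> then 0 else SOME g. homogeneous m g \<and> c' m = coset S g)" for m
      have h: "homogeneous m (h m) \<and> c' m = coset S (h m)" for m
      proof (cases "c' m = \<zero>\<^bsub>?R\<^esub>")
        case True
        then show ?thesis by (simp add: h_def homogeneous_zero coset_zero)
      next
        case False
        have "\<exists>g. homogeneous m g \<and> c' m = coset S g" using c' by (auto simp: coordinate_degree_eq)
        from someI_ex[OF this] show ?thesis using False by (simp add: h_def)
      qed
      let ?U = "{m. c' m \<noteq> \<zero>\<^bsub>?R\<^esub>}"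
      have "c' = (\<lambda>m. coset S (h m))" using h by auto
      then have "x = coset S (sum h ?U)" using x' coset_finsum[OF fin, of S h] by simp
      then have "f - sum h ?U \<in> vanishing_ideal S" using x coset_eq_iff by blast
      then have "vanishes S l (homogeneous_part l (f - sum h ?U))" by (simp add: vanishing_ideal_iff)
      moreover have "homogeneous_part l (sum h ?U) = h l"
      proof -
        have "homogeneous_part l (sum h ?U) = (\<Sum>m\<in>?U. if m = l then h l else 0)"
          unfolding homogeneous_part_sum
        proof (rule sum.cong)
          fix m
          show "homogeneous_part l (h m) = (if m = l then h l else 0)"
            using homogeneous_part_homogeneous[of m "h m" l] h[of m] by simp
        qed simp
        also have "\<dots> = h l" using fin by (auto simp: sum.delta h_def)
        finally show ?thesis .
      qed
      ultimately have "homogeneous_part l f - h l \<in> vanishing_ideal S"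
        using vanishes_in_ideal by (metis homogeneous_part_diff)
      then show "c' l = c l" using h[of l] coset_eq_iff[of S "homogeneous_part l f" "h l"] by (simp add: c_def)
    qed
    then show ?thesis using c by (intro ex1I[of _ c]) auto
  qed
  have scalar: "x \<in> ?G 0 \<longleftrightarrow> (\<exists>a. x = coset S (Poly_Mapping.single 0 a))" for x
    by (auto simp: coordinate_degree_eq homogeneous_0_iff)
  have scalar_zero: "coset S (Poly_Mapping.single 0 a) = \<zero>\<^bsub>?R\<^esub> \<longleftrightarrow> a = 0" for a
  proof -
    have "homogeneous 0 (Poly_Mapping.single 0 a :: ('a, 'b) mpoly)" by (auto simp: homogeneous_0_iff)
    then show ?thesis using coset_eq_zero vanishing_constant[OF assms] vanishes_zero by fastforce
  qed
  have "subfield (?G 0) ?R"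
  proof (rule Q.subfieldI)
    have "subring (?G 0) ?R"
    proof (rule Q.subringI)
      show "?G 0 \<subseteq> carrier ?R" by (auto simp: coordinate_degree_eq coset_carrier)
      show "\<one>\<^bsub>?R\<^esub> \<in> ?G 0" unfolding scalar coset_one by (metis single_one)
      show "\<ominus>\<^bsub>?R\<^esub> x \<in> ?G 0" if "x \<in> ?G 0" for x
        using sub that by (rule additive_subgroup.a_inv_closed)
      show "x \<otimes>\<^bsub>?R\<^esub> y \<in> ?G 0" if "x \<in> ?G 0" "y \<in> ?G 0" for x y
        using mult[OF that] by simp
      show "x \<oplus>\<^bsub>?R\<^esub> y \<in> ?G 0" if "x \<in> ?G 0" "y \<in> ?G 0" for x y
        using additive_subgroup.a_closed[OF sub that] .
    qed
    then show "subcring (?G 0) ?R" by (rule Q.subcringI')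
    have prod: "coset S (Poly_Mapping.single 0 a) \<otimes>\<^bsub>?R\<^esub> coset S (Poly_Mapping.single 0 b) =
      coset S (Poly_Mapping.single 0 (a * b))" for a b by (simp add: coset_mult mult_single)
    have one: "\<one>\<^bsub>?R\<^esub> = coset S (Poly_Mapping.single 0 1)" by (simp add: coset_one)
    show "Units (?R\<lparr>carrier := ?G 0\<rparr>) = ?G 0 - {\<zero>\<^bsub>?R\<^esub>}"
    proof (intro equalityI subsetI)
      fix x assume "x \<in> Units (?R\<lparr>carrier := ?G 0\<rparr>)"
      then obtain y where xy: "x \<in> ?G 0" "y \<in> ?G 0" "x \<otimes>\<^bsub>?R\<^esub> y = \<one>\<^bsub>?R\<^esub>" by (auto simp: Units_def)
      have "y \<in> carrier ?R" using xy(2) by (auto simp: coordinate_degree_eq coset_carrier)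
      then have "x \<noteq> \<zero>\<^bsub>?R\<^esub>" using xy(3) scalar_zero[of 1] one by auto
      then show "x \<in> ?G 0 - {\<zero>\<^bsub>?R\<^esub>}" using xy by blast
    next
      fix x assume "x \<in> ?G 0 - {\<zero>\<^bsub>?R\<^esub>}"
      then obtain a where x: "x = coset S (Poly_Mapping.single 0 a)" "a \<noteq> 0"
        using scalar scalar_zero by blast
      then have "x \<otimes>\<^bsub>?R\<^esub> coset S (Poly_Mapping.single 0 (inverse a)) = \<one>\<^bsub>?R\<^esub>"
        "coset S (Poly_Mapping.single 0 (inverse a)) \<otimes>\<^bsub>?R\<^esub> x = \<one>\<^bsub>?R\<^esub>"
        unfolding x(1) prod one by simp_all
      moreover have "x \<in> ?G 0" "coset S (Poly_Mapping.single 0 (inverse a)) \<in> ?G 0"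
        using x(1) scalar by blast+
      ultimately show "x \<in> Units (?R\<lparr>carrier := ?G 0\<rparr>)" unfolding Units_def by auto
    qed
  qed
  then show ?thesis
    using sub mult decomposition by (intro graded_algebra.intro graded_algebra_axioms.intro cring_coordinate_ring)
qed

section \<open>Two independent sets of points\<close>

lemma poly_eval_scale:
  assumes "homogeneous m f"
  shows "poly_eval f (c *s v) = c ^ m * poly_eval f v"
proof -
  have "Poly_Mapping.lookup f t * (\<Prod>i\<in>UNIV. ((c *s v) $ i) ^ Poly_Mapping.lookup t i) =
      c ^ m * (Poly_Mapping.lookup f t * (\<Prod>i\<in>UNIV. (v $ i) ^ Poly_Mapping.lookup t i))"
    if "t \<in> Poly_Mapping.keys f" for t
  proof -
    have "monomial_degree t = m" using assms that by (auto simp: homogeneous_def)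
    then have "(\<Prod>i\<in>UNIV. c ^ Poly_Mapping.lookup t i) = c ^ m" by (simp flip: power_sum)
    then show ?thesis by (simp add: power_mult_distrib prod.distrib mult_ac)
  qed
  then show ?thesis unfolding poly_eval_def sum_distrib_left by (rule sum.cong[OF refl])
qed

definition linear_form :: "('n::finite \<Rightarrow> 'k::field) \<Rightarrow> ('k, 'n) mpoly" where
  "linear_form a = (\<Sum>i\<in>UNIV. Poly_Mapping.single (Poly_Mapping.single i 1) (a i))"

lemma homogeneous_linear_form: "homogeneous 1 (linear_form a)"
proof -
  have "homogeneous 1 (Poly_Mapping.single (Poly_Mapping.single i 1) (a i))" for i
  proof -
    have "monomial_degree (Poly_Mapping.single i 1) = (\<Sum>j\<in>UNIV. if j = i then 1 else 0)"
      by (rule sum.cong) (auto simp: lookup_single)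
    then show ?thesis using homogeneous_single[of "Poly_Mapping.single i 1" "a i"] by simp
  qed
  then have "homogeneous 1 (\<Sum>i\<in>I. Poly_Mapping.single (Poly_Mapping.single i 1) (a i))" for I
    by (induction I rule: infinite_finite_induct) (simp_all add: homogeneous_zero homogeneous_add)
  then show ?thesis by (simp add: linear_form_def)
qed

lemma poly_eval_linear_form: "poly_eval (linear_form a) v = (\<Sum>i\<in>UNIV. a i * v $ i)"
proof -
  have "(\<Prod>j\<in>UNIV. (v $ j) ^ Poly_Mapping.lookup (Poly_Mapping.single i 1) j) =
      (\<Prod>j\<in>UNIV. if j = i then v $ i else 1)" for i
    by (rule prod.cong) (auto simp: lookup_single)
  then show ?thesis by (simp add: linear_form_def poly_eval_sum poly_eval_single)
qed

text \<open>Extend the assignment of \<open>1\<close> to \<open>b\<close> and \<open>0\<close> to the other vectors of \<open>B\<close> linearly; the extension takes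
values in the coordinate space, and any fixed coordinate of it is the required form.\<close>

lemma dual_linear_form:
  assumes "vec.independent B" "b \<in> B"
  shows "\<exists>f. homogeneous 1 f \<and> poly_eval f b = 1 \<and> (\<forall>c\<in>B - {b}. poly_eval f c = 0)"
proof -
  obtain g where g: "Vector_Spaces.linear (*s) (*s) g" and gB: "\<And>c. c \<in> B \<Longrightarrow> g c = (if c = b then 1 else 0)"
    using vec.linear_independent_extend[OF assms(1), of "\<lambda>c. if c = b then 1 else 0"] by blast
  define f where "f = linear_form (\<lambda>i. matrix g $ undefined $ i)"
  have "poly_eval f c = g c $ undefined" for c
  proof -
    have "g c = matrix g *v c" by (simp add: matrix_works[OF g])
    then show ?thesis by (simp add: f_def poly_eval_linear_form matrix_vector_mult_def)
  qed
  moreover have "homogeneous 1 f" unfolding f_def by (rule homogeneous_linear_form)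
  ultimately show ?thesis using gB assms(2) by (intro exI[of _ f]) simp
qed

lemma proj_point_span:
  assumes "p \<in> proj_space" "v \<in> p" "v \<noteq> 0"
  shows "p = vec.span {v}"
proof -
  obtain u where p: "p = vec.span {u}" using assms(1) by (auto simp: proj_space_def)
  then obtain c where v: "v = c *s u" using assms(2) by (auto simp: vec.span_singleton)
  then have "c \<noteq> 0" using assms(3) by auto
  then have "u = inverse c *s v" by (simp add: v vector_smult_assoc)
  then have "u \<in> vec.span {v}" using vec.span_singleton[of v] by auto
  then have "vec.span {u} \<subseteq> vec.span {v}" by (intro vec.span_minimal vec.subspace_span) auto
  moreover have "vec.span {v} \<subseteq> vec.span {u}"
    using assms(2) p by (intro vec.span_minimal vec.subspace_span) auto
  ultimately show ?thesis using p by blast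
qed

theorem corollary0p2:
  fixes S S\<^sub>1 S\<^sub>2 :: "('k::field ^ 'n::finite) set set"
  assumes "S \<subseteq> proj_space" and "finite S"
    and "S = S\<^sub>1 \<union> S\<^sub>2" and "S\<^sub>1 \<inter> S\<^sub>2 = {}"
    and "proj_independent S\<^sub>1" and "proj_independent S\<^sub>2"
    and "proj_span S\<^sub>1 \<inter> S\<^sub>2 = {}" and "proj_span S\<^sub>2 \<inter> S\<^sub>1 = {}"
  shows "koszul_set S"
proof -
  obtain r\<^sub>1 where r\<^sub>1: "\<And>p. p \<in> S\<^sub>1 \<Longrightarrow> r\<^sub>1 p \<in> p \<and> r\<^sub>1 p \<noteq> 0" "vec.independent (r\<^sub>1 ` S\<^sub>1)"
    using assms(5) unfolding proj_independent_def by blast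
  obtain r\<^sub>2 where r\<^sub>2: "\<And>p. p \<in> S\<^sub>2 \<Longrightarrow> r\<^sub>2 p \<in> p \<and> r\<^sub>2 p \<noteq> 0" "vec.independent (r\<^sub>2 ` S\<^sub>2)"
    using assms(6) unfolding proj_independent_def by blast
  \<comment> \<open>Representing vectors for all points at once; the halves are disjoint.\<close>
  define r where "r p = (if p \<in> S\<^sub>1 then r\<^sub>1 p else r\<^sub>2 p)" for p
  have rp: "r p \<in> p" "r p \<noteq> 0" if "p \<in> S" for p
    using that r\<^sub>1(1) r\<^sub>2(1) assms(3) by (auto simp: r_def)
  have "r ` S\<^sub>1 = r\<^sub>1 ` S\<^sub>1" "r ` S\<^sub>2 = r\<^sub>2 ` S\<^sub>2" using assms(4) by (force simp: r_def)+
  then have independent: "vec.independent (r ` S\<^sub>1)" "vec.independent (r ` S\<^sub>2)" using r\<^sub>1 r\<^sub>2 by simp_all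
  have span: "p = vec.span {r p}" if "p \<in> S" for p
    using proj_point_span rp[OF that] that assms(1) by blast
  have r_inj: "p = q" if "r p = r q" "p \<in> S" "q \<in> S" for p q
    using span[OF that(2)] span[OF that(3)] that(1) by simp
  have nonempty: "p \<noteq> {}" if "p \<in> S" for p using rp[OF that] by blast
  have sub: "S\<^sub>1 \<subseteq> S" "S\<^sub>2 \<subseteq> S" using assms(3) by auto
  let ?R = "coordinate_ring S" and ?G = "coordinate_degree S"
  \<comment> \<open>A homogeneous coset is evaluated through any homogeneous representative of the same degree.\<close>
  define ev where "ev m x p = poly_eval (SOME f. homogeneous m f \<and> x = coset S f) (r p)" for m x p
  have ev: "ev m (coset S f) p = poly_eval f (r p)" if f: "homogeneous m f" and p: "p \<in> S" for m f p
  proof -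
    define g where "g = (SOME g. homogeneous m g \<and> coset S f = coset S g)"
    have g: "homogeneous m g \<and> coset S f = coset S g"
      unfolding g_def by (rule someI[of _ f]) (simp add: f)
    then have "f - g \<in> vanishing_ideal S" using coset_eq_iff by blast
    then have "vanishes S m (f - g)"
      using homogeneous_in_vanishing_ideal[OF homogeneous_diff] f g by blast
    moreover have "S \<noteq> {}" using p by blast
    ultimately have "poly_eval (f - g) (r p) = 0" using p rp(1)[OF p] by (simp add: vanishes_def)
    then show ?thesis by (simp add: ev_def g_def poly_eval_diff)
  qed
  have GE: "\<exists>f. homogeneous m f \<and> x = coset S f" if "x \<in> ?G m" for x m
    using that by (auto simp: coordinate_degree_eq)
  have GI: "coset S f \<in> ?G m" if "homogeneous m f" for f m
    using that by (auto simp: coordinate_degree_eq)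
  have independent_form: "\<exists>x\<in>?G 1. ev 1 x s \<noteq> 0 \<and> (\<forall>p\<in>T - {s}. ev 1 x p = 0)"
    if T: "T \<subseteq> S" "vec.independent (r ` T)" "s \<in> T" for T s
  proof -
    obtain f where f: "homogeneous 1 f" "poly_eval f (r s) = 1" "\<And>v. v \<in> r ` T - {r s} \<Longrightarrow> poly_eval f v = 0"
      using dual_linear_form[OF T(2), of "r s"] T(3) by blast
    have "ev 1 (coset S f) p = 0" if p: "p \<in> T - {s}" for p
    proof -
      have "p \<in> S" "s \<in> S" "p \<noteq> s" using p T by blast+
      then have "r p \<in> r ` T - {r s}" using r_inj p by blast
      then show ?thesis using ev[OF f(1) \<open>p \<in> S\<close>] f(3) by simp
    qed
    moreover have "ev 1 (coset S f) s \<noteq> 0" using ev[OF f(1), of s] f(2) T by auto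
    ultimately show ?thesis using GI[OF f(1)] by blast
  qed
  have separating_form: "\<exists>x\<in>?G 1. ev 1 x s \<noteq> 0 \<and> (\<forall>p\<in>T. ev 1 x p = 0)"
    if T: "T \<subseteq> S" "vec.independent (r ` T)" and s: "s \<in> S" "s \<notin> proj_span T" for T s
  proof -
    have "r s \<notin> vec.span (r ` T)"
    proof
      assume "r s \<in> vec.span (r ` T)"
      moreover have "r ` T \<subseteq> \<Union>T" using rp T by blast
      ultimately have "r s \<in> vec.span (\<Union>T)" using vec.span_mono by blast
      then have "vec.span {r s} \<subseteq> vec.span (\<Union>T)" by (intro vec.span_minimal vec.subspace_span) auto
      then show False using s assms(1) span[OF s(1)] unfolding proj_span_def by auto
    qed
    moreover from this have "s \<notin> T" using vec.span_base by blast
    ultimately have "vec.independent (r ` insert s T)" using T(2) by (simp add: vec.independent_insertI)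
    from independent_form[OF _ this, of s] show ?thesis using T s \<open>s \<notin> T\<close> by auto
  qed
  have "point_algebra ?R ?G ev S\<^sub>1 S\<^sub>2"
  proof (rule point_algebra.intro, rule graded_algebra_coordinate_ring[OF nonempty],
      assumption, rule point_algebra_axioms.intro; (unfold assms(3)[symmetric])?)
    show "finite S\<^sub>1" "finite S\<^sub>2" using assms(2) sub finite_subset by blast+
    show "ev m (x \<oplus>\<^bsub>?R\<^esub> y) p = ev m x p + ev m y p"
      if xy: "x \<in> ?G m" "y \<in> ?G m" "p \<in> S" for x y m p
    proof -
      obtain f g where "homogeneous m f" "x = coset S f" "homogeneous m g" "y = coset S g"
        using GE[OF xy(1)] GE[OF xy(2)] by blast
      then show ?thesis using xy(3) by (simp add: coset_add ev homogeneous_add poly_eval_add)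
    qed
    show "ev (m + l) (x \<otimes>\<^bsub>?R\<^esub> y) p = ev m x p * ev l y p"
      if xy: "x \<in> ?G m" "y \<in> ?G l" "p \<in> S" for x y m l p
    proof -
      obtain f g where "homogeneous m f" "x = coset S f" "homogeneous l g" "y = coset S g"
        using GE[OF xy(1)] GE[OF xy(2)] by blast
      then show ?thesis using xy(3) by (simp add: coset_mult ev homogeneous_mult poly_eval_mult)
    qed
    show "x = \<zero>\<^bsub>?R\<^esub>" if x: "x \<in> ?G m" "0 < m" "\<And>p. p \<in> S \<Longrightarrow> ev m x p = 0" for x m
    proof -
      obtain f where f: "homogeneous m f" "x = coset S f" using GE[OF x(1)] by blast
      have "poly_eval f v = 0" if p: "p \<in> S" "v \<in> p" for p v
      proof -
        obtain c where "v = c *s r p" using span[OF p(1)] p(2) by (auto simp: vec.span_singleton)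
        then show ?thesis using x(3)[OF p(1)] ev[OF f(1) p(1)] f poly_eval_scale[OF f(1)] by simp
      qed
      then have "vanishes S m f" using f(1) x(2) by (simp add: vanishes_def)
      then show ?thesis using coset_eq_zero[OF f(1)] f(2) by simp
    qed
    show "\<exists>a\<in>?G 0. \<forall>p\<in>S. ev 0 a p = c" for c
    proof -
      have c: "homogeneous 0 (Poly_Mapping.single 0 c :: ('k, 'n) mpoly)" by (auto simp: homogeneous_0_iff)
      show ?thesis using GI[OF c] ev[OF c] by (intro bexI[of _ "coset S (Poly_Mapping.single 0 c)"]) (auto simp: poly_eval_single)
    qed
    show "\<exists>x\<in>?G 1. ev 1 x s \<noteq> 0 \<and> (\<forall>p\<in>S\<^sub>1 - {s}. ev 1 x p = 0)" if "s \<in> S\<^sub>1" for s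
      using that sub independent by (intro independent_form)
    show "\<exists>x\<in>?G 1. ev 1 x s \<noteq> 0 \<and> (\<forall>p\<in>S\<^sub>2 - {s}. ev 1 x p = 0)" if "s \<in> S\<^sub>2" for s
      using that sub independent by (intro independent_form)
    show "\<exists>x\<in>?G 1. ev 1 x s \<noteq> 0 \<and> (\<forall>p\<in>S\<^sub>2. ev 1 x p = 0)" if "s \<in> S\<^sub>1" for s
      using that sub independent assms(8) by (intro separating_form) auto
    show "\<exists>x\<in>?G 1. ev 1 x s \<noteq> 0 \<and> (\<forall>p\<in>S\<^sub>1. ev 1 x p = 0)" if "s \<in> S\<^sub>2" for s
      using that sub independent assms(7) by (intro separating_form) auto
  qed
  then show ?thesis unfolding koszul_set_def by (rule point_algebra.koszul)
qed

end
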